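(* Let $\mathcal M=(M,\mathcal L=\tfrac12L,-\nabla^v\phi)$ be a conservative conic pseudo-Finslerian mechanical system, where $L:\mathcal U\to\mathbb R$ is a conic pseudo-Finslerian metric on $M$ and $\phi:M\to\mathbb R$ is a smooth potential. Then the mechanical energy $\mathcal E=\mathcal L+\phi\circ\pi$ is constant along any motion: if $\gamma:I\to M$ is a motion of $\mathcal M$, then $t\mapsto\mathcal E(\gamma'(t))$ is constant on $I$.
   Context: Let $M$ be a smooth manifold, $\pi:TM\to M$ the projection, and $\mathcal U\subset TM\setminus 0$ an open set invariant under positive scalar multiplication. A conic pseudo-Finslerian metric is a smooth function $L:\mathcal U\to\mathbb R$ with $L(\lambda v)=\lambda^2L(v)$ for $\lambda>0$ whose fundamental tensor $g_v(u,w)=\tfrac12\frac{\partial^2}{\partial t\partial s}\big|_{t=s=0}L(v+tu+sw)$, $u,w\in T_{\pi(v)}M$, is nondegenerate for every $v\in\mathcal U$. An anisotropic vector field is a smooth map $X:\mathcal U\to TM$ with $X(v)\in T_{\pi(v)}M$. The anisotropic gradient of a smooth $f:M\to\mathbb R$ is the anisotropic vector field $v\mapsto\nabla^vf$ defined by $g_v(\nabla^vf,w)=df_{\pi(v)}(w)$ for all $w\in T_{\pi(v)}M$. An anisotropic linear connection is a map $(v,X,Y)\in\mathcal U\times\mathfrak X(M)\times\mathfrak X(M)\mapsto\nabla^v_XY\in T_{\pi(v)}M$, with $v\mapsto \nabla^v_XY$ an anisotropic vector field, such that for each local vector field $V$ with values in $\mathcal U$, $\nabla^V$ is a linear connection on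 the domain of $V$. The Chern connection of $L$ is the unique anisotropic linear connection that is torsion-free ($\nabla^v_XY-\nabla^v_YX=[X,Y]$) and metric-compatible: $Xg_V(Y,Z)=g_V(\nabla^V_XY,Z)+g_V(Y,\nabla^V_XZ)+2C_V(Y,Z,\nabla^V_XV)$, where $C_v(u_1,u_2,u_3)=\tfrac12\frac{d}{dt}\big|_{t=0}g_{v+tu_1}(u_2,u_3)$. In coordinates put $\nabla^v_{\partial_i}\partial_j=\sum_k\Gamma^k_{ij}(v)\partial_k$. For a smooth curve $\gamma$ with $\gamma'\in\mathcal U$ ($\mathcal U$-admissible) and a vector field $X=\sum_kx_k\,\partial_k\circ\gamma$ along $\gamma$, $D^{\gamma'}_\gamma X=\sum_k\{x_k'+\sum_{ij}\Gamma^k_{ij}(\gamma')\gamma_i'x_j\}\partial_k$. A motion of the conservative system $(M,\tfrac12L,-\nabla^v\phi)$ is a $\mathcal U$-admissible smooth curve $\gamma$ with $D^{\gamma'}_\gamma\gamma'=-\nabla^{\gamma'}\phi$. *)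

theory Defs
  imports "HOL-Analysis.Analysis"
begin

section \<open>Smooth maps between Euclidean spaces\<close>

text \<open>
  Used for open \<open>S\<close>, and for intervals of reals (and relatively open subsets of these), where
  derivatives at an end point are one-sided.
\<close>

fun Ck_on :: "nat \<Rightarrow> 'a::euclidean_space set \<Rightarrow> ('a \<Rightarrow> 'b::euclidean_space) \<Rightarrow> bool" where
  "Ck_on 0 S f \<longleftrightarrow> continuous_on S f"
| "Ck_on (Suc k) S f \<longleftrightarrow>
     (\<forall>x\<in>S. f differentiable (at x within S)) \<and>
     (\<forall>h. Ck_on k S (\<lambda>x. frechet_derivative f (at x within S) h))"

definition smooth_on :: "'a::euclidean_space set \<Rightarrow> ('a \<Rightarrow> 'b::euclidean_space) \<Rightarrow> bool" where
  "smooth_on S f \<longleftrightarrow> (\<forall>k. Ck_on k S f)"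


section \<open>Smooth manifolds\<close>

text \<open>
  A manifold is a topology \<open>M\<close> together with a smooth atlas \<open>A\<close> (not necessarily maximal) with
  values in \<open>real ^ 'n\<close>. A chart is a pair of its domain and its coordinate map.
\<close>

type_synonym ('a, 'n) chart = "'a set \<times> ('a \<Rightarrow> real ^ 'n)"

abbreviation chart_dom :: "('a, 'n::finite) chart \<Rightarrow> 'a set" where
  "chart_dom c \<equiv> fst c"

abbreviation chart_map :: "('a, 'n::finite) chart \<Rightarrow> 'a \<Rightarrow> real ^ 'n" where
  "chart_map c \<equiv> snd c"

abbreviation chart_inv :: "('a, 'n::finite) chart \<Rightarrow> real ^ 'n \<Rightarrow> 'a" where
  "chart_inv c \<equiv> inv_into (chart_dom c) (chart_map c)"

definition is_chart :: "'a topology \<Rightarrow> ('a, 'n::finite) chart \<Rightarrow> bool" where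
  "is_chart M c \<longleftrightarrow>
     openin M (chart_dom c) \<and> open (chart_map c ` chart_dom c) \<and>
     homeomorphic_map (subtopology M (chart_dom c))
       (top_of_set (chart_map c ` chart_dom c)) (chart_map c)"

definition transition :: "('a, 'n::finite) chart \<Rightarrow> ('a, 'n) chart \<Rightarrow> real ^ 'n \<Rightarrow> real ^ 'n" where
  "transition c c' = chart_map c' \<circ> chart_inv c"

definition smooth_atlas :: "'a topology \<Rightarrow> ('a, 'n::finite) chart set \<Rightarrow> bool" where
  "smooth_atlas M A \<longleftrightarrow>
     (\<forall>c\<in>A. is_chart M c) \<and> (\<Union>c\<in>A. chart_dom c) = topspace M \<and>
     (\<forall>c\<in>A. \<forall>c'\<in>A. smooth_on (chart_map c ` (chart_dom c \<inter> chart_dom c')) (transition c c'))"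

definition second_countable_space :: "'a topology \<Rightarrow> bool" where
  "second_countable_space M \<longleftrightarrow>
     (\<exists>\<B>. countable \<B> \<and> (\<forall>B\<in>\<B>. openin M B) \<and>
          (\<forall>W p. openin M W \<and> p \<in> W \<longrightarrow> (\<exists>B\<in>\<B>. p \<in> B \<and> B \<subseteq> W)))"

definition smooth_manifold :: "'a topology \<Rightarrow> ('a, 'n::finite) chart set \<Rightarrow> bool" where
  "smooth_manifold M A \<longleftrightarrow>
     Hausdorff_space M \<and> second_countable_space M \<and> smooth_atlas M A"

definition smooth_fun :: "('a, 'n::finite) chart set \<Rightarrow> 'a set \<Rightarrow> ('a \<Rightarrow> real) \<Rightarrow> bool" where
  "smooth_fun A W f \<longleftrightarrow> (\<forall>c\<in>A. smooth_on (chart_map c ` (W \<inter> chart_dom c)) (f \<circ> chart_inv c))"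


section \<open>The tangent bundle\<close>

text \<open>
  A tangent vector is a base point \<open>p\<close> together with a family of components, one vector of
  \<open>real ^ 'n\<close> for each chart around \<open>p\<close>, related by the differentials of the chart changes.
  Components with respect to anything else are \<open>0\<close>, so that equality of tangent vectors is
  equality of pairs.
\<close>

type_synonym ('a, 'n) tvec = "'a \<times> (('a, 'n) chart \<Rightarrow> real ^ 'n)"

abbreviation base_pt :: "('a, 'n::finite) tvec \<Rightarrow> 'a" where
  "base_pt v \<equiv> fst v"

abbreviation comp_in :: "('a, 'n::finite) chart \<Rightarrow> ('a, 'n) tvec \<Rightarrow> real ^ 'n" where
  "comp_in c v \<equiv> snd v c"

definition tangent_space :: "('a, 'n::finite) chart set \<Rightarrow> 'a \<Rightarrow> ('a, 'n) tvec set" where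
  "tangent_space A p = {(p, \<xi>) | \<xi>.
     (\<forall>c\<in>A. \<forall>c'\<in>A. p \<in> chart_dom c \<and> p \<in> chart_dom c' \<longrightarrow>
        \<xi> c' = frechet_derivative (transition c c') (at (chart_map c p)) (\<xi> c)) \<and>
     (\<forall>c. \<not> (c \<in> A \<and> p \<in> chart_dom c) \<longrightarrow> \<xi> c = 0)}"

definition tangent_bundle :: "'a topology \<Rightarrow> ('a, 'n::finite) chart set \<Rightarrow> ('a, 'n) tvec set" where
  "tangent_bundle M A = (\<Union>p\<in>topspace M. tangent_space A p)"

definition tzero :: "'a \<Rightarrow> ('a, 'n::finite) tvec" where
  "tzero p = (p, \<lambda>c. 0)"

text \<open>Sums are only formed of tangent vectors with the same base point.\<close>

definition tadd :: "('a, 'n::finite) tvec \<Rightarrow> ('a, 'n) tvec \<Rightarrow> ('a, 'n) tvec" where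
  "tadd u w = (base_pt u, \<lambda>c. comp_in c u + comp_in c w)"

definition tscale :: "real \<Rightarrow> ('a, 'n::finite) tvec \<Rightarrow> ('a, 'n) tvec" where
  "tscale r u = (base_pt u, \<lambda>c. r *\<^sub>R comp_in c u)"

definition tdiff :: "('a, 'n::finite) tvec \<Rightarrow> ('a, 'n) tvec \<Rightarrow> ('a, 'n) tvec" where
  "tdiff u w = tadd u (tscale (- 1) w)"

text \<open>The tangent vector at \<open>p\<close> whose components in the chart \<open>c\<close> are \<open>y\<close>.\<close>

definition vec_of :: "('a, 'n::finite) chart set \<Rightarrow> ('a, 'n) chart \<Rightarrow> 'a \<Rightarrow> real ^ 'n \<Rightarrow> ('a, 'n) tvec" where
  "vec_of A c p y = (p, \<lambda>c'. if c' \<in> A \<and> p \<in> chart_dom c'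
     then frechet_derivative (transition c c') (at (chart_map c p)) y else 0)"

text \<open>The chart of the tangent bundle over \<open>c\<close>, and its inverse.\<close>

definition tb_chart :: "('a, 'n::finite) chart \<Rightarrow> ('a, 'n) tvec \<Rightarrow> (real ^ 'n) \<times> (real ^ 'n)" where
  "tb_chart c v = (chart_map c (base_pt v), comp_in c v)"

definition tb_inv :: "('a, 'n::finite) chart set \<Rightarrow> ('a, 'n) chart \<Rightarrow> (real ^ 'n) \<times> (real ^ 'n) \<Rightarrow> ('a, 'n) tvec" where
  "tb_inv A c z = vec_of A c (chart_inv c (fst z)) (snd z)"

definition vecs_over :: "('a, 'n::finite) tvec set \<Rightarrow> 'a set \<Rightarrow> ('a, 'n) tvec set" where
  "vecs_over U W = {v \<in> U. base_pt v \<in> W}"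

definition open_in_TM :: "'a topology \<Rightarrow> ('a, 'n::finite) chart set \<Rightarrow> ('a, 'n) tvec set \<Rightarrow> bool" where
  "open_in_TM M A U \<longleftrightarrow>
     U \<subseteq> tangent_bundle M A \<and> (\<forall>c\<in>A. open (tb_chart c ` vecs_over U (chart_dom c)))"

definition vector_field :: "('a, 'n::finite) chart set \<Rightarrow> 'a set \<Rightarrow> ('a \<Rightarrow> ('a, 'n) tvec) \<Rightarrow> bool" where
  "vector_field A W X \<longleftrightarrow>
     (\<forall>p\<in>W. X p \<in> tangent_space A p) \<and>
     (\<forall>c\<in>A. smooth_on (chart_map c ` (W \<inter> chart_dom c)) (\<lambda>x. comp_in c (X (chart_inv c x))))"

definition chart_at :: "('a, 'n::finite) chart set \<Rightarrow> 'a \<Rightarrow> ('a, 'n) chart" where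
  "chart_at A p = (SOME c. c \<in> A \<and> p \<in> chart_dom c)"

text \<open>The differential \<open>df\<^sub>p(w)\<close> with \<open>p = base_pt w\<close>; its value does not depend on the chart.\<close>

definition differential :: "('a, 'n::finite) chart set \<Rightarrow> ('a \<Rightarrow> real) \<Rightarrow> ('a, 'n) tvec \<Rightarrow> real" where
  "differential A f w = (let c = chart_at A (base_pt w) in
     frechet_derivative (f \<circ> chart_inv c) (at (chart_map c (base_pt w))) (comp_in c w))"

definition lie_bracket :: "('a, 'n::finite) chart set \<Rightarrow>
    ('a \<Rightarrow> ('a, 'n) tvec) \<Rightarrow> ('a \<Rightarrow> ('a, 'n) tvec) \<Rightarrow> 'a \<Rightarrow> ('a, 'n) tvec" where
  "lie_bracket A X Y p = (p, \<lambda>c. if c \<in> A \<and> p \<in> chart_dom c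
     then frechet_derivative (\<lambda>x. comp_in c (Y (chart_inv c x))) (at (chart_map c p)) (comp_in c (X p))
        - frechet_derivative (\<lambda>x. comp_in c (X (chart_inv c x))) (at (chart_map c p)) (comp_in c (Y p))
     else 0)"

definition coord_field :: "('a, 'n::finite) chart set \<Rightarrow> ('a, 'n) chart \<Rightarrow> 'n \<Rightarrow> 'a \<Rightarrow> ('a, 'n) tvec" where
  "coord_field A c i p = vec_of A c p (axis i 1)"


section \<open>Conic pseudo-Finslerian metrics\<close>

definition fund_tensor :: "(('a, 'n::finite) tvec \<Rightarrow> real) \<Rightarrow>
    ('a, 'n) tvec \<Rightarrow> ('a, 'n) tvec \<Rightarrow> ('a, 'n) tvec \<Rightarrow> real" where
  "fund_tensor L v u w =
     1/2 * deriv (\<lambda>t. deriv (\<lambda>s. L (tadd (tadd v (tscale t u)) (tscale s w))) 0) 0"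

definition cartan_tensor :: "(('a, 'n::finite) tvec \<Rightarrow> real) \<Rightarrow>
    ('a, 'n) tvec \<Rightarrow> ('a, 'n) tvec \<Rightarrow> ('a, 'n) tvec \<Rightarrow> ('a, 'n) tvec \<Rightarrow> real" where
  "cartan_tensor L v u1 u2 u3 =
     1/2 * deriv (\<lambda>t. fund_tensor L (tadd v (tscale t u1)) u2 u3) 0"

definition smooth_on_TM :: "('a, 'n::finite) chart set \<Rightarrow> ('a, 'n) tvec set \<Rightarrow>
    (('a, 'n) tvec \<Rightarrow> real) \<Rightarrow> bool" where
  "smooth_on_TM A U F \<longleftrightarrow>
     (\<forall>c\<in>A. smooth_on (tb_chart c ` vecs_over U (chart_dom c)) (\<lambda>z. F (tb_inv A c z)))"

definition conic_domain :: "'a topology \<Rightarrow> ('a, 'n::finite) chart set \<Rightarrow> ('a, 'n) tvec set \<Rightarrow> bool" where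
  "conic_domain M A U \<longleftrightarrow>
     open_in_TM M A U \<and> (\<forall>p. tzero p \<notin> U) \<and> (\<forall>v\<in>U. \<forall>r>0. tscale r v \<in> U)"

definition conic_pseudo_finsler :: "'a topology \<Rightarrow> ('a, 'n::finite) chart set \<Rightarrow>
    ('a, 'n) tvec set \<Rightarrow> (('a, 'n) tvec \<Rightarrow> real) \<Rightarrow> bool" where
  "conic_pseudo_finsler M A U L \<longleftrightarrow>
     conic_domain M A U \<and> smooth_on_TM A U L \<and>
     (\<forall>v\<in>U. \<forall>r>0. L (tscale r v) = r\<^sup>2 * L v) \<and>
     (\<forall>v\<in>U. \<forall>u\<in>tangent_space A (base_pt v).
        (\<forall>w\<in>tangent_space A (base_pt v). fund_tensor L v u w = 0) \<longrightarrow> u = tzero (base_pt v))"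


section \<open>Anisotropic vector fields and connections\<close>

definition anisotropic_field :: "('a, 'n::finite) chart set \<Rightarrow> ('a, 'n) tvec set \<Rightarrow>
    (('a, 'n) tvec \<Rightarrow> ('a, 'n) tvec) \<Rightarrow> bool" where
  "anisotropic_field A U Z \<longleftrightarrow>
     (\<forall>v\<in>U. Z v \<in> tangent_space A (base_pt v)) \<and>
     (\<forall>c\<in>A. smooth_on (tb_chart c ` vecs_over U (chart_dom c)) (\<lambda>z. comp_in c (Z (tb_inv A c z))))"

definition anisotropic_gradient :: "('a, 'n::finite) chart set \<Rightarrow> (('a, 'n) tvec \<Rightarrow> real) \<Rightarrow>
    ('a \<Rightarrow> real) \<Rightarrow> ('a, 'n) tvec \<Rightarrow> ('a, 'n) tvec" where
  "anisotropic_gradient A L f v = (THE u. u \<in> tangent_space A (base_pt v) \<and>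
     (\<forall>w\<in>tangent_space A (base_pt v). fund_tensor L v u w = differential A f w))"

definition linear_connection :: "('a, 'n::finite) chart set \<Rightarrow> 'a set \<Rightarrow>
    (('a \<Rightarrow> ('a, 'n) tvec) \<Rightarrow> ('a \<Rightarrow> ('a, 'n) tvec) \<Rightarrow> 'a \<Rightarrow> ('a, 'n) tvec) \<Rightarrow> bool" where
  "linear_connection A W D \<longleftrightarrow>
     (\<forall>X Y. vector_field A W X \<and> vector_field A W Y \<longrightarrow> vector_field A W (D X Y)) \<and>
     (\<forall>X X' Y. vector_field A W X \<and> vector_field A W X' \<and> vector_field A W Y \<longrightarrow>
        (\<forall>p\<in>W. D (\<lambda>q. tadd (X q) (X' q)) Y p = tadd (D X Y p) (D X' Y p))) \<and>
     (\<forall>X Y Y'. vector_field A W X \<and> vector_field A W Y \<and> vector_field A W Y' \<longrightarrow>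
        (\<forall>p\<in>W. D X (\<lambda>q. tadd (Y q) (Y' q)) p = tadd (D X Y p) (D X Y' p))) \<and>
     (\<forall>f X Y. smooth_fun A W f \<and> vector_field A W X \<and> vector_field A W Y \<longrightarrow>
        (\<forall>p\<in>W. D (\<lambda>q. tscale (f q) (X q)) Y p = tscale (f p) (D X Y p))) \<and>
     (\<forall>f X Y. smooth_fun A W f \<and> vector_field A W X \<and> vector_field A W Y \<longrightarrow>
        (\<forall>p\<in>W. D X (\<lambda>q. tscale (f q) (Y q)) p =
               tadd (tscale (differential A f (X p)) (Y p)) (tscale (f p) (D X Y p))))"

text \<open>
  \<open>N v X Y\<close> is the covariant derivative of \<open>Y\<close> along \<open>X\<close> with reference vector \<open>v\<close>. As for any
  linear connection, \<open>X\<close> and \<open>Y\<close> may be vector fields on any open set \<open>W\<close> around the base point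
  of \<open>v\<close> (coordinate fields, or the local field \<open>V\<close> in the metric compatibility, need not be
  global). A vector field on \<open>W\<close> is represented by a total function whose values off \<open>W\<close> are
  irrelevant: this is the last clause.
\<close>

definition anisotropic_connection :: "'a topology \<Rightarrow> ('a, 'n::finite) chart set \<Rightarrow> ('a, 'n) tvec set \<Rightarrow>
    (('a, 'n) tvec \<Rightarrow> ('a \<Rightarrow> ('a, 'n) tvec) \<Rightarrow> ('a \<Rightarrow> ('a, 'n) tvec) \<Rightarrow> ('a, 'n) tvec) \<Rightarrow> bool" where
  "anisotropic_connection M A U N \<longleftrightarrow> (\<forall>W. openin M W \<longrightarrow>
     (\<forall>X Y. vector_field A W X \<and> vector_field A W Y \<longrightarrow>
        anisotropic_field A (vecs_over U W) (\<lambda>v. N v X Y)) \<and>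
     (\<forall>V. vector_field A W V \<and> V ` W \<subseteq> U \<longrightarrow>
        linear_connection A W (\<lambda>X Y p. N (V p) X Y)) \<and>
     (\<forall>X X' Y Y'. vector_field A W X \<and> vector_field A W Y \<and>
        (\<forall>p\<in>W. X' p = X p \<and> Y' p = Y p) \<longrightarrow>
        (\<forall>v\<in>vecs_over U W. N v X' Y' = N v X Y)))"

definition torsion_free :: "'a topology \<Rightarrow> ('a, 'n::finite) chart set \<Rightarrow> ('a, 'n) tvec set \<Rightarrow>
    (('a, 'n) tvec \<Rightarrow> ('a \<Rightarrow> ('a, 'n) tvec) \<Rightarrow> ('a \<Rightarrow> ('a, 'n) tvec) \<Rightarrow> ('a, 'n) tvec) \<Rightarrow> bool" where
  "torsion_free M A U N \<longleftrightarrow> (\<forall>W X Y. openin M W \<and> vector_field A W X \<and> vector_field A W Y \<longrightarrow>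
     (\<forall>v\<in>vecs_over U W. tdiff (N v X Y) (N v Y X) = lie_bracket A X Y (base_pt v)))"

definition metric_compatible :: "'a topology \<Rightarrow> ('a, 'n::finite) chart set \<Rightarrow> ('a, 'n) tvec set \<Rightarrow>
    (('a, 'n) tvec \<Rightarrow> real) \<Rightarrow>
    (('a, 'n) tvec \<Rightarrow> ('a \<Rightarrow> ('a, 'n) tvec) \<Rightarrow> ('a \<Rightarrow> ('a, 'n) tvec) \<Rightarrow> ('a, 'n) tvec) \<Rightarrow> bool" where
  "metric_compatible M A U L N \<longleftrightarrow> (\<forall>W V X Y Z.
     openin M W \<and> vector_field A W V \<and> V ` W \<subseteq> U \<and>
     vector_field A W X \<and> vector_field A W Y \<and> vector_field A W Z \<longrightarrow>
     (\<forall>p\<in>W. differential A (\<lambda>q. fund_tensor L (V q) (Y q) (Z q)) (X p) =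
        fund_tensor L (V p) (N (V p) X Y) (Z p) + fund_tensor L (V p) (Y p) (N (V p) X Z) +
        2 * cartan_tensor L (V p) (Y p) (Z p) (N (V p) X V)))"

definition chern_connection :: "'a topology \<Rightarrow> ('a, 'n::finite) chart set \<Rightarrow> ('a, 'n) tvec set \<Rightarrow>
    (('a, 'n) tvec \<Rightarrow> real) \<Rightarrow>
    (('a, 'n) tvec \<Rightarrow> ('a \<Rightarrow> ('a, 'n) tvec) \<Rightarrow> ('a \<Rightarrow> ('a, 'n) tvec) \<Rightarrow> ('a, 'n) tvec) \<Rightarrow> bool" where
  "chern_connection M A U L N \<longleftrightarrow>
     anisotropic_connection M A U N \<and> torsion_free M A U N \<and> metric_compatible M A U L N"

text \<open>The Christoffel symbol with upper index \<open>k\<close> and lower indices \<open>i\<close>, \<open>j\<close> in the chart \<open>c\<close>.\<close>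

definition christoffel :: "('a, 'n::finite) chart set \<Rightarrow>
    (('a, 'n) tvec \<Rightarrow> ('a \<Rightarrow> ('a, 'n) tvec) \<Rightarrow> ('a \<Rightarrow> ('a, 'n) tvec) \<Rightarrow> ('a, 'n) tvec) \<Rightarrow>
    ('a, 'n) chart \<Rightarrow> 'n \<Rightarrow> 'n \<Rightarrow> 'n \<Rightarrow> ('a, 'n) tvec \<Rightarrow> real" where
  "christoffel A N c k i j v = comp_in c (N v (coord_field A c i) (coord_field A c j)) $ k"


section \<open>Motions and mechanical energy\<close>

definition smooth_curve :: "'a topology \<Rightarrow> ('a, 'n::finite) chart set \<Rightarrow> real set \<Rightarrow> (real \<Rightarrow> 'a) \<Rightarrow> bool" where
  "smooth_curve M A I \<gamma> \<longleftrightarrow>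
     continuous_map (top_of_set I) M \<gamma> \<and>
     (\<forall>c\<in>A. smooth_on {t \<in> I. \<gamma> t \<in> chart_dom c} (chart_map c \<circ> \<gamma>))"

definition velocity :: "('a, 'n::finite) chart set \<Rightarrow> real set \<Rightarrow> (real \<Rightarrow> 'a) \<Rightarrow> real \<Rightarrow> ('a, 'n) tvec" where
  "velocity A I \<gamma> t = (\<gamma> t, \<lambda>c. if c \<in> A \<and> \<gamma> t \<in> chart_dom c
     then vector_derivative (chart_map c \<circ> \<gamma>) (at t within I) else 0)"

text \<open>The derivative of the field \<open>X\<close> along \<open>\<gamma>\<close>, with reference vector the velocity of \<open>\<gamma>\<close>.\<close>

definition cov_deriv :: "('a, 'n::finite) chart set \<Rightarrow>
    (('a, 'n) tvec \<Rightarrow> ('a \<Rightarrow> ('a, 'n) tvec) \<Rightarrow> ('a \<Rightarrow> ('a, 'n) tvec) \<Rightarrow> ('a, 'n) tvec) \<Rightarrow>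
    real set \<Rightarrow> (real \<Rightarrow> 'a) \<Rightarrow> (real \<Rightarrow> ('a, 'n) tvec) \<Rightarrow> real \<Rightarrow> ('a, 'n) tvec" where
  "cov_deriv A N I \<gamma> X t = (\<gamma> t, \<lambda>c. if c \<in> A \<and> \<gamma> t \<in> chart_dom c
     then (\<chi> k. vector_derivative (\<lambda>s. comp_in c (X s) $ k) (at t within I) +
            (\<Sum>i\<in>UNIV. \<Sum>j\<in>UNIV. christoffel A N c k i j (velocity A I \<gamma> t) *
               comp_in c (velocity A I \<gamma> t) $ i * comp_in c (X t) $ j))
     else 0)"

text \<open>Motions under the anisotropic force field \<open>F\<close>, for the metric with Chern connection \<open>N\<close>.\<close>

definition is_motion :: "'a topology \<Rightarrow> ('a, 'n::finite) chart set \<Rightarrow> ('a, 'n) tvec set \<Rightarrow>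
    (('a, 'n) tvec \<Rightarrow> ('a \<Rightarrow> ('a, 'n) tvec) \<Rightarrow> ('a \<Rightarrow> ('a, 'n) tvec) \<Rightarrow> ('a, 'n) tvec) \<Rightarrow>
    (('a, 'n) tvec \<Rightarrow> ('a, 'n) tvec) \<Rightarrow> real set \<Rightarrow> (real \<Rightarrow> 'a) \<Rightarrow> bool" where
  "is_motion M A U N F I \<gamma> \<longleftrightarrow>
     smooth_curve M A I \<gamma> \<and> (\<forall>t\<in>I. velocity A I \<gamma> t \<in> U) \<and>
     (\<forall>t\<in>I. cov_deriv A N I \<gamma> (velocity A I \<gamma>) t = F (velocity A I \<gamma> t))"

definition mechanical_energy :: "(('a, 'n::finite) tvec \<Rightarrow> real) \<Rightarrow> ('a \<Rightarrow> real) \<Rightarrow> ('a, 'n) tvec \<Rightarrow> real" where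
  "mechanical_energy Lag \<phi> v = Lag v + \<phi> (base_pt v)"

end

theory Submission
  imports Defs
begin

text \<open>
  In a chart around \<open>\<gamma>(t)\<close> write \<open>L = G(x, y)\<close>. Euler's relation for the 2-homogeneous function
  \<open>G(x, \<cdot>)\<close> gives \<open>g\<^sub>v(v, w) = g\<^sub>v(w, v) = 1/2 G\<^sub>y w\<close> and \<open>C\<^sub>v(v, v, w) = 0\<close>. Applying metric
  compatibility to a vector field with constant components \<open>y\<close> therefore yields
  \<open>G\<^sub>x y = G\<^sub>y \<Gamma>\<close> with \<open>\<Gamma>\<^sup>k = \<Sum> \<Gamma>\<^sup>k\<^sub>i\<^sub>j y\<^sup>i y\<^sup>j\<close>. Along a motion, \<open>x' = y\<close> and
  \<open>y' = - \<Gamma> - \<nabla>\<phi>\<close>, so the derivative of the energy is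
  \<open>1/2 (G\<^sub>x y - G\<^sub>y \<Gamma>) - g\<^sub>v(\<nabla>\<phi>, v) + d\<phi>(v) = 0\<close>.
\<close>

section \<open>Calculus of smooth maps\<close>

lemma frechet_within_open:
  assumes "open S" "x \<in> S"
  shows "frechet_derivative f (at x within S) = frechet_derivative f (at x)"
  using at_within_open[OF assms(2,1)] by simp

lemma has_derivative_within_cong:
  assumes "x \<in> S" "\<And>y. y \<in> S \<Longrightarrow> f y = g y"
  shows "(f has_derivative D) (at x within S) \<longleftrightarrow> (g has_derivative D) (at x within S)"
  using has_derivative_transform[OF assms(1), of f g] has_derivative_transform[OF assms(1), of g f]
    assms(2) by metis

lemma frechet_derivative_cong_within:
  assumes "x \<in> S" "\<And>y. y \<in> S \<Longrightarrow> f y = g y"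
  shows "frechet_derivative f (at x within S) = frechet_derivative g (at x within S)"
proof -
  have "(f has_derivative D) (at x within S) \<longleftrightarrow> (g has_derivative D) (at x within S)" for D
    using has_derivative_within_cong[of x S f g, OF assms] .
  then show ?thesis
    unfolding frechet_derivative_def by presburger
qed

text \<open>Derivatives within \<open>S\<close> only see the values on \<open>S\<close>, so every
  iterated derivative agrees as well; \<open>f\<close> and \<open>g\<close> vary in the induction
  because the step passes to their directional derivatives.\<close>

lemma Ck_on_cong:
  assumes "\<And>x. x \<in> S \<Longrightarrow> f x = g x"
  shows "Ck_on k S f \<longleftrightarrow> Ck_on k S g"
  using assms
proof (induction k arbitrary: f g)
  case 0
  then show ?case by (simp cong: continuous_on_cong)
next
  case (Suc k)
  have "f differentiable (at x within S) \<longleftrightarrow> g differentiable (at x within S)" if "x \<in> S" for x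
    unfolding differentiable_def using has_derivative_within_cong[OF that, of f g] Suc.prems by simp
  moreover have "Ck_on k S (\<lambda>x. frechet_derivative f (at x within S) h) \<longleftrightarrow>
      Ck_on k S (\<lambda>x. frechet_derivative g (at x within S) h)" for h
    by (rule Suc.IH) (metis frechet_derivative_cong_within Suc.prems)
  ultimately show ?case by simp
qed

lemma Ck_on_Suc_imp: "Ck_on (Suc k) S f \<Longrightarrow> Ck_on k S f"
proof (induction k arbitrary: f)
  case 0
  then show ?case
    by (auto simp: continuous_on_eq_continuous_within intro: differentiable_imp_continuous_within)
next
  case (Suc k)
  show ?case
    unfolding Ck_on.simps(2)
    using Suc.prems Suc.IH unfolding Ck_on.simps(2)[of "Suc k"] by blast
qed

text \<open>Openness of both sets turns the derivatives within \<open>S\<close> and within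
  \<open>T\<close> into the same full derivative at points of \<open>T\<close>.\<close>

lemma Ck_on_open_subset:
  assumes "open S" "open T" "T \<subseteq> S" "Ck_on k S f"
  shows "Ck_on k T f"
  using assms(4)
proof (induction k arbitrary: f)
  case 0
  then show ?case using assms by (auto intro: continuous_on_subset)
next
  case (Suc k)
  have "Ck_on k T (\<lambda>x. frechet_derivative f (at x within T) h)" for h
  proof -
    have "Ck_on k T (\<lambda>x. frechet_derivative f (at x within S) h)"
      using Suc by auto
    then show ?thesis
      by (rule Ck_on_cong[THEN iffD1, rotated])
        (use assms in \<open>metis frechet_within_open subsetD\<close>)
  qed
  then show ?case
    using Suc.prems assms by (auto intro: differentiable_within_subset)
qed

text \<open>On an open set any explicit family of full derivatives may replace the chosen
  \<open>frechet_derivative\<close>. The closure properties then follow from the usual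
  differentiation rules.\<close>

lemma Ck_on_SucI:
  assumes "open S"
    and "\<And>x. x \<in> S \<Longrightarrow> (f has_derivative D x) (at x)"
    and "\<And>h. Ck_on k S (\<lambda>x. D x h)"
  shows "Ck_on (Suc k) S f"
proof -
  have "frechet_derivative f (at x within S) = D x" if "x \<in> S" for x
    using assms that by (metis frechet_within_open frechet_derivative_at)
  then have "Ck_on k S (\<lambda>x. frechet_derivative f (at x within S) h)" for h
    using Ck_on_cong[of S "\<lambda>x. frechet_derivative f (at x within S) h" "\<lambda>x. D x h" k] assms(3) by simp
  moreover have "f differentiable (at x within S)" if "x \<in> S" for x
    using differentiableI[OF has_derivative_at_withinI[OF assms(2)[OF that]]] .
  ultimately show ?thesis by simp
qed

lemma Ck_on_SucD:
  assumes "open S" "Ck_on (Suc k) S f"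
  shows "\<And>x. x \<in> S \<Longrightarrow> (f has_derivative frechet_derivative f (at x)) (at x)"
    and "\<And>h. Ck_on k S (\<lambda>x. frechet_derivative f (at x) h)"
proof -
  show "(f has_derivative frechet_derivative f (at x)) (at x)" if "x \<in> S" for x
    using assms that at_within_open[OF that assms(1)] by (metis Ck_on.simps(2) frechet_derivative_works)
  have "Ck_on k S (\<lambda>x. frechet_derivative f (at x within S) h)" for h
    using assms by simp
  then show "Ck_on k S (\<lambda>x. frechet_derivative f (at x) h)" for h
    using Ck_on_cong[of S "\<lambda>x. frechet_derivative f (at x within S) h" "\<lambda>x. frechet_derivative f (at x) h" k]
      frechet_within_open[OF assms(1)] by metis
qed

section \<open>Closure of \<open>Ck_on\<close> under algebraic operations and composition\<close>

lemma Ck_on_const: "open S \<Longrightarrow> Ck_on k S (\<lambda>x. c)"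
proof (induction k arbitrary: c)
  case (Suc k)
  show ?case
    by (rule Ck_on_SucI[OF Suc.prems has_derivative_const Suc.IH[OF Suc.prems]])
qed simp

lemma Ck_on_add:
  assumes "open S" "Ck_on k S f" "Ck_on k S g"
  shows "Ck_on k S (\<lambda>x. f x + g x)"
  using assms(2,3)
proof (induction k arbitrary: f g)
  case 0
  then show ?case by (simp add: continuous_on_add continuous_on_inner continuous_on_scaleR)
next
  case (Suc k)
  note D = Ck_on_SucD[OF assms(1) Suc.prems(1)] Ck_on_SucD[OF assms(1) Suc.prems(2)]
  show ?case
    by (rule Ck_on_SucI[OF assms(1) has_derivative_add[OF D(1,3)] Suc.IH[OF D(2,4)]])
qed

lemma Ck_on_sum:
  assumes "open S" "\<And>i. i \<in> J \<Longrightarrow> Ck_on k S (f i)"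
  shows "Ck_on k S (\<lambda>x. \<Sum>i\<in>J. f i x)"
  using assms(2) by (induction J rule: infinite_finite_induct)
    (auto intro: Ck_on_const[OF assms(1)] Ck_on_add[OF assms(1)])

lemma Ck_on_inner_const:
  assumes "open S" "Ck_on k S f"
  shows "Ck_on k S (\<lambda>x. f x \<bullet> b)"
  using assms(2)
proof (induction k arbitrary: f)
  case 0
  then show ?case by (simp add: continuous_on_add continuous_on_inner continuous_on_scaleR)
next
  case (Suc k)
  note D = Ck_on_SucD[OF assms(1) Suc.prems]
  show ?case
    by (rule Ck_on_SucI[OF assms(1) has_derivative_inner_left[OF D(1)] Suc.IH[OF D(2)]])
qed

lemma Ck_on_scaleR:
  fixes u :: "'a::euclidean_space \<Rightarrow> real"
  assumes "open S" "Ck_on k S u" "Ck_on k S f"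
  shows "Ck_on k S (\<lambda>x. u x *\<^sub>R f x)"
  using assms(2,3)
proof (induction k arbitrary: u f)
  case 0
  then show ?case by (simp add: continuous_on_add continuous_on_inner continuous_on_scaleR)
next
  case (Suc k)
  note D = Ck_on_SucD[OF assms(1) Suc.prems(1)] Ck_on_SucD[OF assms(1) Suc.prems(2)]
  show ?case
    \<comment> \<open>The product rule leaves one undifferentiated factor in each summand;
      \<open>Ck_on_Suc_imp\<close> lowers its order to \<open>k\<close> so that the induction
      hypothesis applies.\<close>
    by (rule Ck_on_SucI[OF assms(1) has_derivative_scaleR[OF D(1,3)]])
      (assumption | intro Ck_on_add[OF assms(1)] Suc.IH D(2,4) Suc.prems[THEN Ck_on_Suc_imp])+
qed

text \<open>In the chain rule the outer derivative is taken in a direction that moves with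
  \<open>x\<close>, while \<open>Ck_on\<close> only controls fixed directions. Expanding that
  direction in \<open>Basis\<close> gives a finite sum of scalar functions times fixed directional
  derivatives of \<open>g\<close> composed with \<open>f\<close>, and each of these composites is
  covered by the induction hypothesis.\<close>

lemma Ck_on_compose:
  fixes f :: "'a::euclidean_space \<Rightarrow> 'b::euclidean_space" and g :: "'b \<Rightarrow> 'c::euclidean_space"
  assumes "open S" "open T" "f ` S \<subseteq> T" "Ck_on k S f" "Ck_on k T g"
  shows "Ck_on k S (\<lambda>x. g (f x))"
  using assms(4,5)
proof (induction k arbitrary: g)
  case 0
  then show ?case using assms(3) continuous_on_compose2[of T g S f] by simp
next
  case (Suc k)
  note Df = Ck_on_SucD[OF assms(1) Suc.prems(1)] and Dg = Ck_on_SucD[OF assms(2) Suc.prems(2)]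
  have der: "((\<lambda>x. g (f x)) has_derivative
      (\<lambda>h. \<Sum>b\<in>Basis. (frechet_derivative f (at x) h \<bullet> b) *\<^sub>R frechet_derivative g (at (f x)) b)) (at x)"
    if "x \<in> S" for x
  proof -
    have g: "(g has_derivative frechet_derivative g (at (f x))) (at (f x))"
      using that assms(3) Dg by blast
    then have lin: "linear (frechet_derivative g (at (f x)))"
      by (rule has_derivative_linear)
    have rep: "frechet_derivative g (at (f x)) w =
        (\<Sum>b\<in>Basis. (w \<bullet> b) *\<^sub>R frechet_derivative g (at (f x)) b)" for w
    proof -
      have "frechet_derivative g (at (f x)) w = frechet_derivative g (at (f x)) (\<Sum>b\<in>Basis. (w \<bullet> b) *\<^sub>R b)"
        by (simp only: euclidean_representation)
      then show ?thesis
        by (simp only: linear_sum[OF lin] linear_cmul[OF lin])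
    qed
    show ?thesis
      by (intro has_derivative_eq_rhs[OF has_derivative_compose[where f = f, OF Df(1)[OF that] g]] ext rep)
  qed
  have "Ck_on k S (\<lambda>x. \<Sum>b\<in>Basis. (frechet_derivative f (at x) h \<bullet> b) *\<^sub>R frechet_derivative g (at (f x)) b)" for h
    using Suc.prems(1)[THEN Ck_on_Suc_imp] Df Dg
    by (intro Ck_on_sum Ck_on_scaleR Ck_on_inner_const Suc.IH assms(1))
  with der show ?case
    by (rule Ck_on_SucI[OF assms(1)])
qed

section \<open>Transfer from finite order to smooth maps\<close>

lemma smooth_on_compose:
  fixes f :: "'a::euclidean_space \<Rightarrow> 'b::euclidean_space" and g :: "'b \<Rightarrow> 'c::euclidean_space"
  assumes "open S" "open T" "f ` S \<subseteq> T" "smooth_on S f" "smooth_on T g"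
  shows "smooth_on S (\<lambda>x. g (f x))"
  using assms Ck_on_compose unfolding smooth_on_def by blast

lemma smooth_on_open_subset:
  assumes "open S" "open T" "T \<subseteq> S" "smooth_on S f"
  shows "smooth_on T f"
  using assms Ck_on_open_subset unfolding smooth_on_def by blast

lemma smooth_on_cong:
  assumes "\<And>x. x \<in> S \<Longrightarrow> f x = g x" "smooth_on S g"
  shows "smooth_on S f"
  using assms Ck_on_cong[of S f g] unfolding smooth_on_def by blast

lemma smooth_on_const: "open S \<Longrightarrow> smooth_on S (\<lambda>x. c)"
  by (simp add: smooth_on_def Ck_on_const)

lemma smooth_on_has_derivative:
  assumes "open S" "smooth_on S f" "x \<in> S"
  shows "(f has_derivative frechet_derivative f (at x)) (at x)"
  using Ck_on_SucD(1) assms unfolding smooth_on_def by blast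

lemma smooth_on_directional:
  assumes "open S" "smooth_on S f"
  shows "smooth_on S (\<lambda>x. frechet_derivative f (at x) h)"
  using Ck_on_SucD(2) assms unfolding smooth_on_def by blast


section \<open>Homogeneous functions and nondegenerate bilinear forms\<close>

text \<open>Links the Frechet derivative to the iterated one-variable \<open>deriv\<close> in which
  the fundamental and Cartan tensors are written.\<close>

lemma directional_deriv:
  assumes "(h has_derivative D) (at y)"
  shows "((\<lambda>s. h (y + s *\<^sub>R a)) has_real_derivative D a) (at 0)"
proof -
  have h: "(h has_derivative D) (at (y + 0 *\<^sub>R a))"
    using assms by simp
  have "((\<lambda>s. h (y + s *\<^sub>R a)) has_derivative (\<lambda>s. D (0 + s *\<^sub>R a))) (at 0)"
    by (rule has_derivative_compose[where f = "\<lambda>s. y + s *\<^sub>R a", OF _ h]) (auto intro!: derivative_eq_intros)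
  moreover have "(\<lambda>s. D (0 + s *\<^sub>R a)) = (\<lambda>s. D a * s)"
    using has_derivative_linear[OF assms] by (auto simp: linear_cmul)
  ultimately show ?thesis
    by (simp add: has_field_derivative_def)
qed

lemma eventually_line_in_open:
  fixes y a :: "'b::real_normed_vector"
  assumes "open S" "y \<in> S"
  shows "\<forall>\<^sub>F s in nhds 0. y + s *\<^sub>R a \<in> S"
proof -
  have "((\<lambda>s. y + s *\<^sub>R a) \<longlongrightarrow> y + 0 *\<^sub>R a) (nhds 0)"
    by (intro tendsto_intros) (rule filterlim_ident)
  from topological_tendstoD[OF this assms(1)] show ?thesis
    using assms(2) by simp
qed

text \<open>
  \<open>h\<close> is a metric restricted to a tangent space, identified with a Euclidean space, and \<open>D\<close> its
  derivative. The second derivative is kept as the derivative of \<open>D\<close> in fixed directions; its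
  symmetry is never needed, since Euler's relation gives both \<open>g\<^sub>y(y, a)\<close> and \<open>g\<^sub>y(a, y)\<close>.
\<close>

locale homogeneous_2 =
  fixes S :: "'b::euclidean_space set" and h :: "'b \<Rightarrow> real" and D :: "'b \<Rightarrow> 'b \<Rightarrow> real"
  assumes open_S: "open S"
    and cone: "\<And>y r. y \<in> S \<Longrightarrow> r > 0 \<Longrightarrow> r *\<^sub>R y \<in> S"
    and homog: "\<And>y r. y \<in> S \<Longrightarrow> r > 0 \<Longrightarrow> h (r *\<^sub>R y) = r\<^sup>2 * h y"
    and deriv_h: "\<And>y. y \<in> S \<Longrightarrow> (h has_derivative D y) (at y)"
    and deriv_D: "\<And>y a. y \<in> S \<Longrightarrow> (\<lambda>z. D z a) differentiable (at y)"
begin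

text \<open>Has the same shape as \<open>fund_tensor\<close>, with vector space operations for
  \<open>tadd\<close> and \<open>tscale\<close>, so that the two are identified by unfolding
  alone.\<close>

definition fund :: "'b \<Rightarrow> 'b \<Rightarrow> 'b \<Rightarrow> real" where
  "fund y u w = 1/2 * deriv (\<lambda>t. deriv (\<lambda>s. h (y + t *\<^sub>R u + s *\<^sub>R w)) 0) 0"

text \<open>Differentiating \<open>h (r *\<^sub>R z) = r\<^sup>2 * h z\<close> in \<open>z\<close>
  produces a factor \<open>r\<close> on the left, which cancels: the derivative is homogeneous of
  degree 1.\<close>

lemma D_scale:
  assumes "y \<in> S" "r > 0"
  shows "D (r *\<^sub>R y) a = r * D y a"
proof -
  have "((\<lambda>z. h (r *\<^sub>R z)) has_derivative (\<lambda>z. D (r *\<^sub>R y) (r *\<^sub>R z))) (at y)"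
    by (rule has_derivative_compose[where f = "\<lambda>z. r *\<^sub>R z", OF _ deriv_h[OF cone[OF assms]]])
      (auto intro!: derivative_eq_intros)
  moreover have "((\<lambda>z. h (r *\<^sub>R z)) has_derivative (\<lambda>z. r\<^sup>2 * D y z)) (at y)"
    by (rule has_derivative_transform_within_open[OF has_derivative_mult_right[OF deriv_h[OF assms(1)]] open_S assms(1)])
      (simp add: homog assms(2))
  ultimately have "D (r *\<^sub>R y) (r *\<^sub>R a) = r\<^sup>2 * D y a"
    by (rule has_derivative_unique[THEN fun_cong])
  then have "r * D (r *\<^sub>R y) a = r * (r * D y a)"
    using linear_cmul[OF has_derivative_linear[OF deriv_h[OF cone[OF assms]]], of r a]
    by (simp add: power2_eq_square mult.assoc)
  then show ?thesis
    using assms by simp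
qed

text \<open>Along the ray through \<open>y\<close>, \<open>h\<close> is
  \<open>(1 + s)\<^sup>2 * h y\<close>, whose derivative at 0 is \<open>2 * h y\<close>.\<close>

lemma euler:
  assumes "y \<in> S"
  shows "D y y = 2 * h y"
proof -
  have "((\<lambda>s. h (y + s *\<^sub>R y)) has_real_derivative 2 * h y) (at 0)"
  proof (rule has_field_derivative_transform_within_open[where S = "{-1<..}"])
    show "((\<lambda>s. (1 + s)\<^sup>2 * h y) has_real_derivative 2 * h y) (at 0)"
      by (auto intro!: derivative_eq_intros)
    show "(1 + s)\<^sup>2 * h y = h (y + s *\<^sub>R y)" if "s \<in> {-1<..}" for s
      using homog[OF assms, of "1 + s"] that by (simp add: scaleR_add_left)
  qed auto
  then show ?thesis
    by (rule DERIV_unique[OF directional_deriv[OF deriv_h[OF assms]]])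
qed

text \<open>For all small \<open>t\<close> the point \<open>y + t *\<^sub>R u\<close> stays in the
  open set \<open>S\<close>, so the inner derivative is \<open>D\<close> there, and the outer
  \<open>deriv\<close> depends only on the germ at 0.\<close>

lemma fund_eq_deriv:
  assumes "y \<in> S"
  shows "fund y u w = 1/2 * deriv (\<lambda>t. D (y + t *\<^sub>R u) w) 0"
proof -
  have "\<forall>\<^sub>F t in nhds 0. deriv (\<lambda>s. h (y + t *\<^sub>R u + s *\<^sub>R w)) 0 = D (y + t *\<^sub>R u) w"
    by (rule eventually_mono[OF eventually_line_in_open[OF open_S assms]])
      (intro DERIV_imp_deriv directional_deriv deriv_h)
  then have "deriv (\<lambda>t. deriv (\<lambda>s. h (y + t *\<^sub>R u + s *\<^sub>R w)) 0) 0 = deriv (\<lambda>t. D (y + t *\<^sub>R u) w) 0"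
    by (rule deriv_cong_ev) (rule refl)
  then show ?thesis
    unfolding fund_def by presburger
qed

text \<open>By 1-homogeneity \<open>D\<close> is affine in the parameter of the ray through
  \<open>y\<close>. The base point is moved along this ray by \<open>r\<close> because
  \<open>cartan_self\<close> differentiates in \<open>r\<close>; the plain Euler relation is the
  case \<open>r = 0\<close>.\<close>

lemma fund_self_left:
  assumes "y \<in> S" "r > -1"
  shows "fund (y + r *\<^sub>R y) y w = 1/2 * D y w"
proof -
  have eq: "y + r *\<^sub>R y = (1 + r) *\<^sub>R y"
    by (simp add: scaleR_add_left)
  have "((\<lambda>t. D (y + r *\<^sub>R y + t *\<^sub>R y) w) has_real_derivative D y w) (at 0)"
  proof (rule has_field_derivative_transform_within_open[where S = "{- (1 + r)<..}"])
    show "((\<lambda>t. (1 + r + t) * D y w) has_real_derivative D y w) (at 0)"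
      by (auto intro!: derivative_eq_intros)
    show "(1 + r + t) * D y w = D (y + r *\<^sub>R y + t *\<^sub>R y) w" if "t \<in> {- (1 + r)<..}" for t
      using D_scale[OF assms(1), of "1 + r + t"] that by (simp add: scaleR_add_left)
  qed (use assms in auto)
  then show ?thesis
    using fund_eq_deriv[of "y + r *\<^sub>R y" y w] cone[OF assms(1), of "1 + r"] assms(2)
    by (simp add: eq DERIV_imp_deriv)
qed

lemma fund_self_self: "y \<in> S \<Longrightarrow> fund y y y = h y"
  using fund_self_left[of y 0 y] euler[of y] by simp

lemma fund_eq_second:
  assumes "y \<in> S"
  shows "fund y u w = 1/2 * frechet_derivative (\<lambda>z. D z w) (at y) u"
  using fund_eq_deriv[OF assms]
    DERIV_imp_deriv[OF directional_deriv[OF frechet_derivative_works[THEN iffD1, OF deriv_D[OF assms]]]]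
  by simp

text \<open>Here the fixed slot is the second one. Euler's relation at
  \<open>z = y + t *\<^sub>R u\<close> and linearity of \<open>D z\<close> give
  \<open>D z y = 2 * h z - t * D z u\<close>; the derivative at \<open>t = 0\<close> is
  \<open>2 * D y u - D y u\<close>.\<close>

lemma fund_self_right:
  assumes "y \<in> S"
  shows "fund y u y = 1/2 * D y u"
proof -
  obtain S' where *: "open S'" "0 \<in> S'" "\<And>t. t \<in> S' \<Longrightarrow> y + t *\<^sub>R u \<in> S"
    using eventually_line_in_open[OF open_S assms, of u] unfolding eventually_nhds by blast
  have "((\<lambda>t. D (y + t *\<^sub>R u) y) has_real_derivative D y u) (at 0)"
  proof (rule has_field_derivative_transform_within_open[where S = S'])
    have q: "((\<lambda>t. D (y + t *\<^sub>R u) u) has_real_derivative frechet_derivative (\<lambda>z. D z u) (at y) u) (at 0)"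
      by (rule directional_deriv) (use deriv_D[OF assms] frechet_derivative_works in blast)
    show "((\<lambda>t. 2 * h (y + t *\<^sub>R u) - t * D (y + t *\<^sub>R u) u) has_real_derivative D y u) (at 0)"
      by (rule derivative_eq_intros directional_deriv deriv_h assms q refl | simp)+
    show "2 * h (y + t *\<^sub>R u) - t * D (y + t *\<^sub>R u) u = D (y + t *\<^sub>R u) y" if "t \<in> S'" for t
    proof -
      let ?z = "y + t *\<^sub>R u"
      have "linear (D ?z)"
        using has_derivative_linear deriv_h *(3)[OF that] by blast
      then have "D ?z ?z = D ?z y + t * D ?z u"
        by (simp add: linear_add linear_cmul)
      then show ?thesis
        using euler[OF *(3)[OF that]] by simp
    qed
  qed (use * in auto)
  then show ?thesis
    using fund_eq_deriv[OF assms] by (simp add: DERIV_imp_deriv)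
qed

text \<open>The differentiated function is constant for \<open>t > -1\<close> by
  \<open>fund_self_left\<close>.\<close>

lemma cartan_self:
  assumes "y \<in> S"
  shows "deriv (\<lambda>t. fund (y + t *\<^sub>R y) y w) 0 = 0"
proof -
  have "((\<lambda>t. fund (y + t *\<^sub>R y) y w) has_real_derivative 0) (at 0)"
    by (rule has_field_derivative_transform_within_open[where S = "{-1<..}" and f = "\<lambda>t. 1/2 * D y w"])
      (use fund_self_left[OF assms] in auto)
  then show ?thesis
    by (rule DERIV_imp_deriv)
qed

text \<open>Linearity in the first slot is that of a derivative. In the second slot it is inherited
  from \<open>D z\<close>, which is linear for every \<open>z\<close> in the open set
  \<open>S\<close>, hence near \<open>y\<close>.\<close>

lemma fund_bilinear:
  assumes "y \<in> S"
  shows "bilinear (fund y)"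
proof -
  have lin: "linear (frechet_derivative (\<lambda>z. D z w) (at y))" for w
    using deriv_D[OF assms] by (rule linear_frechet_derivative)
  have Dlin: "linear (D z)" if "z \<in> S" for z
    using deriv_h[OF that] by (rule has_derivative_linear)
  have dD: "((\<lambda>z. D z w) has_derivative frechet_derivative (\<lambda>z. D z w) (at y)) (at y)" for w
    using deriv_D[OF assms] frechet_derivative_works by blast
  have add: "frechet_derivative (\<lambda>z. D z (v + w)) (at y) u =
      frechet_derivative (\<lambda>z. D z v) (at y) u + frechet_derivative (\<lambda>z. D z w) (at y) u" for v w u
  proof -
    have "((\<lambda>z. D z (v + w)) has_derivative
        (\<lambda>u. frechet_derivative (\<lambda>z. D z v) (at y) u + frechet_derivative (\<lambda>z. D z w) (at y) u)) (at y)"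
      by (rule has_derivative_transform_within_open[OF has_derivative_add[OF dD dD] open_S assms])
        (simp add: linear_add[OF Dlin])
    from frechet_derivative_at[OF this] show ?thesis by metis
  qed
  have scale: "frechet_derivative (\<lambda>z. D z (r *\<^sub>R w)) (at y) u =
      r * frechet_derivative (\<lambda>z. D z w) (at y) u" for r w u
  proof -
    have "((\<lambda>z. D z (r *\<^sub>R w)) has_derivative
        (\<lambda>u. r * frechet_derivative (\<lambda>z. D z w) (at y) u)) (at y)"
      by (rule has_derivative_transform_within_open[OF has_derivative_mult_right[OF dD] open_S assms])
        (simp add: linear_cmul[OF Dlin])
    from frechet_derivative_at[OF this] show ?thesis by metis
  qed
  show ?thesis
    unfolding bilinear_def
    by (auto intro!: linearI simp: fund_eq_second[OF assms] add scale
        linear_add[OF lin] linear_cmul[OF lin] algebra_simps)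
qed

end

text \<open>\<open>T u\<close> is the vector representing \<open>B u\<close> under the Euclidean
  inner product. Nondegeneracy makes \<open>T\<close> injective, hence surjective in finite
  dimension, so the vector representing \<open>l\<close> is reached.\<close>

lemma nondegenerate_represents:
  fixes B :: "'b::euclidean_space \<Rightarrow> 'b \<Rightarrow> real"
  assumes "bilinear B" and nondeg: "\<And>u. (\<And>w. B u w = 0) \<Longrightarrow> u = 0" and "linear l"
  shows "\<exists>!u. \<forall>w. B u w = l w"
proof -
  have linl: "linear (\<lambda>u. B u w)" and linr: "linear (B u)" for u w
    using assms(1) by (auto simp: bilinear_def)
  define T where "T u = (\<Sum>b\<in>Basis. B u b *\<^sub>R b)" for u
  have T: "T u \<bullet> b = B u b" if "b \<in> Basis" for u b
    using that by (simp add: T_def inner_sum_left inner_Basis if_distrib cong: if_cong)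
  have ext: "B u = f" if "linear f" "\<And>b. b \<in> Basis \<Longrightarrow> B u b = f b" for u and f :: "'b \<Rightarrow> real"
    using linear_eq_stdbasis[OF linr[of u] that] .
  have "linear T"
    unfolding T_def by (intro linear_compose_sum ballI) (auto intro!: linearI
        simp: linear_add[OF linl] linear_cmul[OF linl] algebra_simps)
  moreover have "inj T"
    unfolding linear_inj_iff_eq_0[OF \<open>linear T\<close>]
  proof (intro allI impI nondeg)
    fix u w assume "T u = 0"
    then have "B u b = 0" if "b \<in> Basis" for b
      using T[OF that, of u] by simp
    then show "B u w = 0"
      using ext[of "\<lambda>w. 0"] by (metis linear_zero)
  qed
  ultimately have "surj T"
    by (rule eucl.linear_inj_imp_surj)
  then obtain u where u: "T u = (\<Sum>b\<in>Basis. l b *\<^sub>R b)"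
    by (metis surjD)
  have "B u b = l b" if "b \<in> Basis" for b
    using T[OF that, of u] that unfolding u
    by (simp add: inner_sum_left inner_Basis if_distrib cong: if_cong)
  then have "\<forall>w. B u w = l w"
    using ext[OF \<open>linear l\<close>] by metis
  moreover have "v = u" if "\<forall>w. B v w = l w" for v
  proof -
    have "v - u = 0"
      by (rule nondeg) (use that \<open>\<forall>w. B u w = l w\<close> in \<open>simp add: linear_diff[OF linl]\<close>)
    then show ?thesis by simp
  qed
  ultimately show ?thesis by blast
qed


section \<open>Components in a chart\<close>

locale atlas =
  fixes M :: "'a topology" and A :: "('a, 'n::finite) chart set"
  assumes smooth_atlas: "smooth_atlas M A"
begin

abbreviation dtrans :: "('a, 'n) chart \<Rightarrow> ('a, 'n) chart \<Rightarrow> 'a \<Rightarrow> real ^ 'n \<Rightarrow> real ^ 'n" where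
  "dtrans c c' p \<equiv> frechet_derivative (transition c c') (at (chart_map c p))"

lemma is_chart: "c \<in> A \<Longrightarrow> is_chart M c"
  using smooth_atlas by (simp add: smooth_atlas_def)

lemma openin_dom: "c \<in> A \<Longrightarrow> openin M (chart_dom c)"
  using is_chart by (simp add: is_chart_def)

lemma dom_subset: "c \<in> A \<Longrightarrow> chart_dom c \<subseteq> topspace M"
  using openin_dom openin_subset by blast

lemma chart_at_props:
  assumes "p \<in> topspace M"
  shows "chart_at A p \<in> A" "p \<in> chart_dom (chart_at A p)"
proof -
  have "\<exists>c. c \<in> A \<and> p \<in> chart_dom c"
    using assms smooth_atlas unfolding smooth_atlas_def by blast
  from someI_ex[OF this] show "chart_at A p \<in> A" "p \<in> chart_dom (chart_at A p)"
    by (simp_all add: chart_at_def)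
qed

lemma homeo_chart:
  assumes "c \<in> A"
  shows "homeomorphic_map (subtopology M (chart_dom c)) (top_of_set (chart_map c ` chart_dom c)) (chart_map c)"
    and "open (chart_map c ` chart_dom c)"
  using is_chart[OF assms] by (simp_all add: is_chart_def)

lemma inj_chart:
  assumes "c \<in> A"
  shows "inj_on (chart_map c) (chart_dom c)"
  using homeomorphic_imp_injective_map[OF homeo_chart(1)[OF assms]] dom_subset[OF assms]
  by (simp add: Int_absorb1)

lemma chart_inv_chart_map: "c \<in> A \<Longrightarrow> p \<in> chart_dom c \<Longrightarrow> chart_inv c (chart_map c p) = p"
  by (simp add: inj_chart)

lemma chart_map_inject: "c \<in> A \<Longrightarrow> p \<in> chart_dom c \<Longrightarrow> q \<in> chart_dom c \<Longrightarrow>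
    chart_map c p = chart_map c q \<longleftrightarrow> p = q"
  using inj_chart by (meson inj_on_eq_iff)

lemma open_chart_image:
  assumes "c \<in> A" "openin M W"
  shows "open (chart_map c ` (W \<inter> chart_dom c))"
proof -
  have "openin (subtopology M (chart_dom c)) (W \<inter> chart_dom c)"
    using assms(2) by (auto simp: openin_subtopology)
  then have "openin (top_of_set (chart_map c ` chart_dom c)) (chart_map c ` (W \<inter> chart_dom c))"
    using homeomorphic_map_openness_eq[OF homeo_chart(1)[OF assms(1)]] by blast
  then show ?thesis
    using homeo_chart(2)[OF assms(1)] openin_open_trans by blast
qed

lemma openin_chart_preimage:
  assumes "c \<in> A" "open T"
  shows "openin M {q \<in> chart_dom c. chart_map c q \<in> T}"
proof -
  have "openin (top_of_set (chart_map c ` chart_dom c)) (chart_map c ` chart_dom c \<inter> T)"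
    using assms(2) by (rule openin_open_Int)
  from openin_continuous_map_preimage[OF homeomorphic_imp_continuous_map[OF homeo_chart(1)[OF assms(1)]] this]
  have "openin (subtopology M (chart_dom c)) {q \<in> chart_dom c. chart_map c q \<in> T}"
    by (rule back_subst[of "openin _"]) (use dom_subset[OF assms(1)] in auto)
  then show ?thesis
    using openin_dom[OF assms(1)] openin_trans_full by blast
qed

section \<open>Transition maps and their differentials\<close>

lemma transition_chart_map: "c \<in> A \<Longrightarrow> p \<in> chart_dom c \<Longrightarrow> transition c c' (chart_map c p) = chart_map c' p"
  by (simp add: transition_def chart_inv_chart_map)

lemma open_overlap: "c \<in> A \<Longrightarrow> c' \<in> A \<Longrightarrow> open (chart_map c ` (chart_dom c \<inter> chart_dom c'))"
  using open_chart_image[OF _ openin_dom] by (metis Int_commute)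

lemma smooth_transition:
  "c \<in> A \<Longrightarrow> c' \<in> A \<Longrightarrow> smooth_on (chart_map c ` (chart_dom c \<inter> chart_dom c')) (transition c c')"
  using smooth_atlas by (simp add: smooth_atlas_def)

lemma transition_has_derivative:
  assumes "c \<in> A" "c' \<in> A" "p \<in> chart_dom c" "p \<in> chart_dom c'"
  shows "(transition c c' has_derivative dtrans c c' p) (at (chart_map c p))"
  by (rule smooth_on_has_derivative[OF open_overlap smooth_transition]) (use assms in auto)

lemma linear_dtrans:
  assumes "c \<in> A" "c' \<in> A" "p \<in> chart_dom c" "p \<in> chart_dom c'"
  shows "linear (dtrans c c' p)"
  using transition_has_derivative[OF assms] by (rule has_derivative_linear)

text \<open>The cocycle rule: two transitions compose to the third on the image of the triple
  overlap, an open set around the point, and the chain rule applies there.\<close>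

lemma dtrans_chain:
  assumes "c \<in> A" "c' \<in> A" "c'' \<in> A"
    and "p \<in> chart_dom c" "p \<in> chart_dom c'" "p \<in> chart_dom c''"
  shows "dtrans c c'' p y = dtrans c' c'' p (dtrans c c' p y)"
proof -
  let ?T = "chart_map c ` ((chart_dom c' \<inter> chart_dom c'') \<inter> chart_dom c)"
  have "(transition c' c'' has_derivative dtrans c' c'' p) (at (transition c c' (chart_map c p)))"
    using transition_has_derivative[of c' c'' p] assms by (simp add: transition_chart_map)
  from has_derivative_compose[where f = "transition c c'", OF transition_has_derivative this]
  have "((\<lambda>x. transition c' c'' (transition c c' x)) has_derivative
      (\<lambda>y. dtrans c' c'' p (dtrans c c' p y))) (at (chart_map c p))"
    using assms by blast
  moreover have "open ?T"
    by (intro open_chart_image openin_Int openin_dom assms)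
  moreover have "chart_map c p \<in> ?T"
    using assms by blast
  moreover have "transition c' c'' (transition c c' x) = transition c c'' x" if "x \<in> ?T" for x
    using that assms by (auto simp: transition_chart_map)
  ultimately have "(transition c c'' has_derivative (\<lambda>y. dtrans c' c'' p (dtrans c c' p y))) (at (chart_map c p))"
    by (rule has_derivative_transform_within_open)
  from frechet_derivative_at[OF this] show ?thesis
    by metis
qed

lemma dtrans_self:
  assumes "c \<in> A" "p \<in> chart_dom c"
  shows "dtrans c c p y = y"
proof -
  have "(transition c c has_derivative (\<lambda>y. y)) (at (chart_map c p))"
    by (rule has_derivative_transform_within_open[OF has_derivative_ident homeo_chart(2)[OF assms(1)]])
      (use assms in \<open>auto simp: transition_chart_map\<close>)
  from frechet_derivative_at[OF this] show ?thesis
    by metis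
qed

section \<open>Tangent vectors given by their components in one chart\<close>

lemma base_vec_of: "base_pt (vec_of A c p y) = p"
  by (simp add: vec_of_def)

lemma comp_vec_of: "c \<in> A \<Longrightarrow> p \<in> chart_dom c \<Longrightarrow> comp_in c (vec_of A c p y) = y"
  by (simp add: vec_of_def dtrans_self)

lemma vec_of_in_tangent_space:
  assumes "c \<in> A" "p \<in> chart_dom c"
  shows "vec_of A c p y \<in> tangent_space A p"
  unfolding tangent_space_def vec_of_def
  by (intro CollectI exI[of _ "\<lambda>c'. if c' \<in> A \<and> p \<in> chart_dom c' then dtrans c c' p y else 0"]
      conjI refl ballI allI impI)
    (auto simp: dtrans_chain[OF assms(1) _ _ assms(2), symmetric])

text \<open>The components in one chart determine those in every chart around \<open>p\<close>, and
  all remaining entries have the default value 0. Calculations with tangent vectors thereby reduce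
  to vectors of \<open>real ^ 'n\<close>.\<close>

lemma tangent_vector_eq:
  assumes "c \<in> A" "p \<in> chart_dom c" "v \<in> tangent_space A p"
  shows "v = vec_of A c p (comp_in c v)"
proof -
  obtain \<xi> where v: "v = (p, \<xi>)"
    and \<xi>: "\<And>c'. c' \<in> A \<Longrightarrow> p \<in> chart_dom c' \<Longrightarrow> \<xi> c' = dtrans c c' p (\<xi> c)"
      "\<And>c'. \<not> (c' \<in> A \<and> p \<in> chart_dom c') \<Longrightarrow> \<xi> c' = 0"
    using assms unfolding tangent_space_def by blast
  show ?thesis
    unfolding v vec_of_def prod.inject snd_conv
    by (intro conjI refl ext) (metis \<xi>)
qed

lemma tangent_vectorE:
  assumes "c \<in> A" "p \<in> chart_dom c" "v \<in> tangent_space A p"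
  obtains y where "v = vec_of A c p y"
  using tangent_vector_eq[OF assms] by (rule that)

lemma tadd_vec_of:
  assumes "c \<in> A" "p \<in> chart_dom c"
  shows "tadd (vec_of A c p y) (vec_of A c p z) = vec_of A c p (y + z)"
  using linear_add[OF linear_dtrans[OF assms(1) _ assms(2)]] by (auto simp: tadd_def vec_of_def)

lemma tscale_vec_of:
  assumes "c \<in> A" "p \<in> chart_dom c"
  shows "tscale r (vec_of A c p y) = vec_of A c p (r *\<^sub>R y)"
  using linear_cmul[OF linear_dtrans[OF assms(1) _ assms(2)]] by (auto simp: tscale_def vec_of_def)

text \<open>Constant components in \<open>c\<close> are not constant in \<open>c'\<close>: they
  become a directional derivative of the transition from \<open>c\<close> to \<open>c'\<close>,
  evaluated along the transition back, which is smooth as a composite.\<close>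

lemma vector_field_vec_of:
  assumes "c \<in> A" "openin M W" "W \<subseteq> chart_dom c"
  shows "vector_field A W (\<lambda>q. vec_of A c q y)"
  unfolding vector_field_def
proof (intro conjI ballI)
  show "vec_of A c p y \<in> tangent_space A p" if "p \<in> W" for p
    using that assms vec_of_in_tangent_space by blast
  fix c' assume c': "c' \<in> A"
  let ?S = "chart_map c' ` (W \<inter> chart_dom c')" and ?T = "chart_map c ` (chart_dom c \<inter> chart_dom c')"
  have "smooth_on ?S (\<lambda>x. frechet_derivative (transition c c') (at (transition c' c x)) y)"
  proof (rule smooth_on_compose[where f = "transition c' c" and T = ?T and
        g = "\<lambda>x. frechet_derivative (transition c c') (at x) y"])
    show S: "open ?S"
      using open_chart_image c' assms by blast
    show T: "open ?T"
      by (rule open_overlap[OF assms(1) c'])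
    show "transition c' c ` ?S \<subseteq> ?T"
      using assms c' by (auto simp: transition_chart_map)
    show "smooth_on ?S (transition c' c)"
      by (rule smooth_on_open_subset[OF open_overlap S _ smooth_transition])
        (use assms c' in auto)
    show "smooth_on ?T (\<lambda>x. frechet_derivative (transition c c') (at x) y)"
      by (rule smooth_on_directional[OF T smooth_transition[OF assms(1) c']])
  qed
  moreover have eq: "comp_in c' (vec_of A c (chart_inv c' x) y) =
      frechet_derivative (transition c c') (at (transition c' c x)) y" if x: "x \<in> ?S" for x
  proof -
    obtain q where "q \<in> W \<inter> chart_dom c'" "x = chart_map c' q"
      using x by (rule imageE)
    then show ?thesis
      using assms(3) c' by (simp add: vec_of_def chart_inv_chart_map transition_chart_map subset_iff)
  qed
  ultimately show "smooth_on ?S (\<lambda>x. comp_in c' (vec_of A c (chart_inv c' x) y))"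
    by (intro smooth_on_cong[OF eq])
qed

end


section \<open>The metric on a fibre\<close>

locale finsler = atlas M A for M :: "'a topology" and A :: "('a, 'n::finite) chart set" +
  fixes U :: "('a, 'n) tvec set" and L :: "('a, 'n) tvec \<Rightarrow> real"
  assumes finsler: "conic_pseudo_finsler M A U L"
begin

definition coord_domain :: "('a, 'n) chart \<Rightarrow> ((real ^ 'n) \<times> (real ^ 'n)) set" where
  "coord_domain c = tb_chart c ` vecs_over U (chart_dom c)"

definition coord_metric :: "('a, 'n) chart \<Rightarrow> (real ^ 'n) \<times> (real ^ 'n) \<Rightarrow> real" where
  "coord_metric c z = L (tb_inv A c z)"

text \<open>Values at \<open>(a, 0)\<close> are derivatives in the base point with the components
  fixed, values at \<open>(0, a)\<close> are derivatives along the fibre.\<close>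

abbreviation coord_deriv :: "('a, 'n) chart \<Rightarrow> 'a \<Rightarrow> real ^ 'n \<Rightarrow> (real ^ 'n) \<times> (real ^ 'n) \<Rightarrow> real" where
  "coord_deriv c p y \<equiv> frechet_derivative (coord_metric c) (at (chart_map c p, y))"

lemmas finsler_conjuncts = finsler[unfolded conic_pseudo_finsler_def]

lemma conic_domain: "conic_domain M A U"
  using finsler_conjuncts by (rule conjunct1)

lemma U_subset: "U \<subseteq> tangent_bundle M A"
  using conic_domain unfolding conic_domain_def open_in_TM_def by blast

lemma open_coord_domain: "c \<in> A \<Longrightarrow> open (coord_domain c)"
  using conic_domain unfolding coord_domain_def conic_domain_def open_in_TM_def by blast

lemma U_cone: "v \<in> U \<Longrightarrow> r > 0 \<Longrightarrow> tscale r v \<in> U"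
  using conic_domain unfolding conic_domain_def by blast

lemma L_homogeneous: "v \<in> U \<Longrightarrow> r > 0 \<Longrightarrow> L (tscale r v) = r\<^sup>2 * L v"
  using finsler_conjuncts[THEN conjunct2, THEN conjunct2, THEN conjunct1] by blast

lemma nondegenerate:
  assumes "v \<in> U" "u \<in> tangent_space A (base_pt v)"
    and "\<And>w. w \<in> tangent_space A (base_pt v) \<Longrightarrow> fund_tensor L v u w = 0"
  shows "u = tzero (base_pt v)"
  using finsler_conjuncts[THEN conjunct2, THEN conjunct2, THEN conjunct2, rule_format, OF assms(1,2)] assms(3)
  by simp

lemma smooth_coord_metric: "c \<in> A \<Longrightarrow> smooth_on (coord_domain c) (coord_metric c)"
  using finsler_conjuncts[THEN conjunct2, THEN conjunct1]
  unfolding coord_domain_def coord_metric_def smooth_on_TM_def by blast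

lemma in_U_tangent:
  assumes "v \<in> U"
  shows "v \<in> tangent_space A (base_pt v)"
proof -
  obtain p where p: "v \<in> tangent_space A p"
    using U_subset assms unfolding tangent_bundle_def by blast
  then have "base_pt v = p"
    unfolding tangent_space_def by fastforce
  with p show ?thesis by simp
qed

lemma coord_domain_iff:
  assumes "c \<in> A" "p \<in> chart_dom c"
  shows "(chart_map c p, y) \<in> coord_domain c \<longleftrightarrow> vec_of A c p y \<in> U"
proof
  assume "(chart_map c p, y) \<in> coord_domain c"
  then obtain v where "v \<in> vecs_over U (chart_dom c)" "(chart_map c p, y) = tb_chart c v"
    unfolding coord_domain_def by (rule imageE)
  then have v: "v \<in> U" "base_pt v \<in> chart_dom c" "chart_map c (base_pt v) = chart_map c p"
      "comp_in c v = y"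
    by (simp_all add: vecs_over_def tb_chart_def)
  then have "base_pt v = p"
    using chart_map_inject[OF assms(1)] assms(2) by blast
  then have "v = vec_of A c p y"
    using tangent_vector_eq[OF assms, of v] in_U_tangent[OF v(1)] unfolding v(4) by blast
  with v(1) show "vec_of A c p y \<in> U"
    by blast
next
  assume *: "vec_of A c p y \<in> U"
  have "tb_chart c (vec_of A c p y) = (chart_map c p, y)"
    using assms by (simp add: tb_chart_def base_vec_of comp_vec_of)
  with * show "(chart_map c p, y) \<in> coord_domain c"
    unfolding coord_domain_def using assms(2)
    by (intro image_eqI[of _ _ "vec_of A c p y"]) (simp_all add: vecs_over_def base_vec_of)
qed

lemma coord_metric_eq: "c \<in> A \<Longrightarrow> p \<in> chart_dom c \<Longrightarrow> coord_metric c (chart_map c p, y) = L (vec_of A c p y)"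
  by (simp add: coord_metric_def tb_inv_def chart_inv_chart_map)

lemma coord_metric_has_derivative:
  assumes "c \<in> A" "p \<in> chart_dom c" "vec_of A c p y \<in> U"
  shows "(coord_metric c has_derivative coord_deriv c p y) (at (chart_map c p, y))"
  using coord_domain_iff[OF assms(1,2)] assms(3)
  by (simp add: smooth_on_has_derivative[OF open_coord_domain smooth_coord_metric, OF assms(1) assms(1)])

text \<open>Freezing the base point turns smoothness of the coordinate metric on the product into
  differentiability along the slice \<open>Pair (chart_map c p)\<close>; the cone and scaling
  properties come from those of \<open>U\<close> and \<open>L\<close>.\<close>

lemma fibre_homogeneous:
  assumes "c \<in> A" "p \<in> chart_dom c"
  shows "homogeneous_2 {y. vec_of A c p y \<in> U} (\<lambda>y. L (vec_of A c p y)) (\<lambda>y a. coord_deriv c p y (0, a))"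
proof
  have Pair: "((\<lambda>y. (chart_map c p, y)) has_derivative (\<lambda>a. (0, a))) (at y)" for y
    by (intro has_derivative_Pair has_derivative_const has_derivative_ident)
  have "{y. vec_of A c p y \<in> U} = Pair (chart_map c p) -` coord_domain c"
    using coord_domain_iff[OF assms] by auto
  moreover have "open (Pair (chart_map c p) -` coord_domain c)"
    by (rule open_vimage[OF open_coord_domain[OF assms(1)]]) (intro continuous_intros)
  ultimately show "open {y. vec_of A c p y \<in> U}"
    by simp
  show "r *\<^sub>R y \<in> {y. vec_of A c p y \<in> U}" if "y \<in> {y. vec_of A c p y \<in> U}" "0 < r" for y r
    using U_cone[of "vec_of A c p y" r] that by (simp add: tscale_vec_of[OF assms])
  show "L (vec_of A c p (r *\<^sub>R y)) = r\<^sup>2 * L (vec_of A c p y)"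
    if "y \<in> {y. vec_of A c p y \<in> U}" "0 < r" for y r
    using L_homogeneous[of "vec_of A c p y" r] that by (simp add: tscale_vec_of[OF assms])
  show "((\<lambda>y. L (vec_of A c p y)) has_derivative (\<lambda>a. coord_deriv c p y (0, a))) (at y)"
    if "y \<in> {y. vec_of A c p y \<in> U}" for y
    using has_derivative_compose[where f = "\<lambda>y. (chart_map c p, y)", OF Pair coord_metric_has_derivative[OF assms]] that
    by (simp add: coord_metric_eq[OF assms])
  show "(\<lambda>z. coord_deriv c p z (0, a)) differentiable (at y)"
    if "y \<in> {y. vec_of A c p y \<in> U}" for y a
  proof -
    have "(chart_map c p, y) \<in> coord_domain c"
      using that coord_domain_iff[OF assms] by blast
    then have "((\<lambda>z. frechet_derivative (coord_metric c) (at z) (0, a)) has_derivative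
        frechet_derivative (\<lambda>z. frechet_derivative (coord_metric c) (at z) (0, a)) (at (chart_map c p, y)))
        (at (chart_map c p, y))"
      by (intro smooth_on_has_derivative[OF open_coord_domain[OF assms(1)]]
          smooth_on_directional open_coord_domain smooth_coord_metric assms(1))
    then show ?thesis
      by (rule differentiableI[OF has_derivative_compose[where f = "\<lambda>y. (chart_map c p, y)", OF Pair]])
  qed
qed

section \<open>Fundamental tensor, Cartan tensor and gradient in components\<close>

context
  fixes c p
  assumes c: "c \<in> A" and p: "p \<in> chart_dom c"
begin

interpretation F: homogeneous_2 "{y. vec_of A c p y \<in> U}" "\<lambda>y. L (vec_of A c p y)"
    "\<lambda>y a. coord_deriv c p y (0, a)"
  using c p by (rule fibre_homogeneous)

lemma fund_tensor_vec_of: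
  "fund_tensor L (vec_of A c p y) (vec_of A c p u) (vec_of A c p w) = F.fund y u w"
  unfolding fund_tensor_def F.fund_def tscale_vec_of[OF c p] tadd_vec_of[OF c p] ..

lemma fund_tensor_self_self:
  assumes "vec_of A c p y \<in> U"
  shows "fund_tensor L (vec_of A c p y) (vec_of A c p y) (vec_of A c p y) = L (vec_of A c p y)"
  using F.fund_self_self assms by (simp add: fund_tensor_vec_of)

lemma fund_tensor_self:
  assumes "vec_of A c p y \<in> U"
  shows "fund_tensor L (vec_of A c p y) (vec_of A c p y) (vec_of A c p w) = 1/2 * coord_deriv c p y (0, w)"
    and "fund_tensor L (vec_of A c p y) (vec_of A c p u) (vec_of A c p y) = 1/2 * coord_deriv c p y (0, u)"
  using F.fund_self_left[of y 0 w] F.fund_self_right[of y u] assms by (simp_all add: fund_tensor_vec_of)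

lemma cartan_tensor_self:
  assumes "vec_of A c p y \<in> U"
  shows "cartan_tensor L (vec_of A c p y) (vec_of A c p y) (vec_of A c p y) (vec_of A c p w) = 0"
  using F.cartan_self[of y w] assms
  by (simp add: cartan_tensor_def tscale_vec_of[OF c p] tadd_vec_of[OF c p] fund_tensor_vec_of)

text \<open>Nondegeneracy yields a unique component vector representing \<open>l\<close>, so the
  \<open>THE\<close> in the gradient is well defined. Testing the defining equation against
  \<open>y\<close> itself and using Euler's relation in the second slot evaluates the fibre
  derivative on the gradient.\<close>

lemma gradient_represents:
  assumes y: "vec_of A c p y \<in> U" and l: "linear l"
    and df: "\<And>w. differential A f (vec_of A c p w) = l w"
  shows "\<exists>\<eta>. anisotropic_gradient A L f (vec_of A c p y) = vec_of A c p \<eta> \<and>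
    1/2 * coord_deriv c p y (0, \<eta>) = l y"
proof -
  have "u = 0" if "\<And>w. F.fund y u w = 0" for u
  proof -
    have "fund_tensor L (vec_of A c p y) (vec_of A c p u) w = 0" if "w \<in> tangent_space A p" for w
      using c p that by (rule tangent_vectorE) (simp add: fund_tensor_vec_of \<open>\<And>w. F.fund y u w = 0\<close>)
    then have "vec_of A c p u = tzero p"
      using nondegenerate[OF y, of "vec_of A c p u"] vec_of_in_tangent_space[OF c p] by (simp add: base_vec_of)
    then show ?thesis
      using comp_vec_of[OF c p, of u] by (simp add: tzero_def)
  qed
  then have "\<exists>!u. \<forall>w. F.fund y u w = l w"
    using y l by (intro nondegenerate_represents[OF F.fund_bilinear]) simp_all
  then obtain \<eta> where \<eta>: "\<And>w. F.fund y \<eta> w = l w" and uniq: "\<And>u. \<forall>w. F.fund y u w = l w \<Longrightarrow> u = \<eta>"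
    by (elim ex1E) blast
  have "anisotropic_gradient A L f (vec_of A c p y) = vec_of A c p \<eta>"
    unfolding anisotropic_gradient_def base_vec_of
  proof (rule the_equality)
    have "fund_tensor L (vec_of A c p y) (vec_of A c p \<eta>) w = differential A f w" if "w \<in> tangent_space A p" for w
      using c p that by (rule tangent_vectorE) (simp add: fund_tensor_vec_of \<eta> df)
    then show "vec_of A c p \<eta> \<in> tangent_space A p \<and>
        (\<forall>w\<in>tangent_space A p. fund_tensor L (vec_of A c p y) (vec_of A c p \<eta>) w = differential A f w)"
      using vec_of_in_tangent_space[OF c p] by blast
  next
    fix u assume u: "u \<in> tangent_space A p \<and>
        (\<forall>w\<in>tangent_space A p. fund_tensor L (vec_of A c p y) u w = differential A f w)"
    then obtain \<eta>' where eq: "u = vec_of A c p \<eta>'"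
      by (elim conjE tangent_vectorE[OF c p])
    have "F.fund y \<eta>' w = l w" for w
      using u[THEN conjunct2, rule_format, OF vec_of_in_tangent_space[OF c p], of w]
      by (simp add: eq fund_tensor_vec_of df)
    then show "u = vec_of A c p \<eta>"
      using uniq[of \<eta>'] eq by simp
  qed
  moreover have "1/2 * coord_deriv c p y (0, \<eta>) = l y"
    using \<eta>[of y] F.fund_self_right[of y \<eta>] y by simp
  ultimately show ?thesis
    by (intro exI conjI)
qed

end

end


section \<open>The spray identity\<close>

lemma linear_axis_expansion:
  fixes f :: "real ^ 'n::finite \<Rightarrow> 'b::real_vector"
  assumes "linear f"
  shows "f y = (\<Sum>i\<in>UNIV. y $ i *\<^sub>R f (axis i 1))"
proof -
  have "f y = f (\<Sum>i\<in>UNIV. y $ i *\<^sub>R axis i 1)"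
    using basis_expansion[of y] by (simp add: scalar_mult_eq_scaleR)
  then show ?thesis
    by (simp only: linear_sum[OF assms] linear_cmul[OF assms])
qed

context atlas
begin

text \<open>The scaling clauses of a linear connection are stated for smooth coefficient functions;
  constants are the ones used in expanding the connection below.\<close>

lemma smooth_fun_const:
  assumes "openin M W"
  shows "smooth_fun A W (\<lambda>q. r)"
  unfolding smooth_fun_def o_def using assms by (intro ballI smooth_on_const open_chart_image)

lemma differential_const: "differential A (\<lambda>q. r) w = 0"
  by (simp add: differential_def Let_def o_def)

end

locale chern = finsler M A U L
  for M :: "'a topology" and A :: "('a, 'n::finite) chart set"
    and U :: "('a, 'n) tvec set" and L :: "('a, 'n) tvec \<Rightarrow> real" +
  fixes N :: "('a, 'n) tvec \<Rightarrow> ('a \<Rightarrow> ('a, 'n) tvec) \<Rightarrow> ('a \<Rightarrow> ('a, 'n) tvec) \<Rightarrow> ('a, 'n) tvec"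
  assumes chern: "chern_connection M A U L N"
begin

lemma anisotropic_connection: "anisotropic_connection M A U N"
  using chern unfolding chern_connection_def by (rule conjunct1)

lemma metric_compatible: "metric_compatible M A U L N"
  using chern unfolding chern_connection_def by (elim conjE)

context
  fixes W V
  assumes W: "openin M W" and V: "vector_field A W V" and VU: "V ` W \<subseteq> U"
begin

lemma linear_connection_N: "linear_connection A W (\<lambda>X Y p. N (V p) X Y)"
  using anisotropic_connection[unfolded anisotropic_connection_def, rule_format, OF W,
      THEN conjunct2, THEN conjunct1, rule_format, OF conjI[OF V VU]] .

lemma in_vecs_over:
  assumes "p \<in> W"
  shows "V p \<in> vecs_over U W"
proof -
  have "V p \<in> tangent_space A p"
    using V assms unfolding vector_field_def by blast
  then have "base_pt (V p) = p"
    unfolding tangent_space_def by fastforce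
  then show ?thesis
    using VU assms by (auto simp: vecs_over_def)
qed

text \<open>Rules such as additivity of \<open>vec_of\<close> in its components are available only
  over the chart domain, so fields must be exchangeable when they agree merely on
  \<open>W\<close>.\<close>

lemma N_cong:
  assumes "p \<in> W" "vector_field A W X" "vector_field A W Y"
    and "\<And>q. q \<in> W \<Longrightarrow> X' q = X q" "\<And>q. q \<in> W \<Longrightarrow> Y' q = Y q"
  shows "N (V p) X' Y' = N (V p) X Y"
  using anisotropic_connection[unfolded anisotropic_connection_def, rule_format, OF W,
      THEN conjunct2, THEN conjunct2] in_vecs_over[OF assms(1)] assms(2-5) by blast

lemma N_tangent:
  assumes "p \<in> W" "vector_field A W X" "vector_field A W Y"
  shows "N (V p) X Y \<in> tangent_space A p"
proof -
  have "anisotropic_field A (vecs_over U W) (\<lambda>v. N v X Y)"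
    using anisotropic_connection[unfolded anisotropic_connection_def, rule_format, OF W,
      THEN conjunct1, rule_format, OF conjI[OF assms(2,3)]] .
  moreover have "base_pt (V p) = p"
    using V assms(1) unfolding vector_field_def tangent_space_def by fastforce
  ultimately show ?thesis
    using in_vecs_over[OF assms(1)] unfolding anisotropic_field_def by metis
qed

end

text \<open>With the reference field held at constant components \<open>y\<close>, the connection is
  bilinear on fields with constant components, since the Leibniz term of a constant coefficient
  vanishes. Expanding both arguments in the coordinate fields gives the Christoffel sum.\<close>

lemma N_components:
  assumes c: "c \<in> A" and W: "openin M W" "W \<subseteq> chart_dom c"
    and VU: "(\<lambda>q. vec_of A c q y) ` W \<subseteq> U" and p: "p \<in> W"
  shows "comp_in c (N (vec_of A c p y) (\<lambda>q. vec_of A c q y) (\<lambda>q. vec_of A c q y)) =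
    (\<chi> k. \<Sum>i\<in>UNIV. \<Sum>j\<in>UNIV. christoffel A N c k i j (vec_of A c p y) * y $ i * y $ j)"
proof -
  define E where "E a = (\<lambda>q. vec_of A c q a)" for a
  define B where "B a b = comp_in c (N (E y p) (E a) (E b))" for a b
  have E: "vector_field A W (E a)" for a
    unfolding E_def using c W by (rule vector_field_vec_of)
  have VU': "E y ` W \<subseteq> U"
    using VU by (simp add: E_def)
  have dom: "q \<in> W \<Longrightarrow> q \<in> chart_dom c" for q
    using W by blast
  note cong = N_cong[OF W(1) E VU' p E E]
  note lin = linear_connection_N[OF W(1) E VU', unfolded linear_connection_def, THEN conjunct2]
  have add: "E (a + b) q = tadd (E a q) (E b q)" and scale: "E (r *\<^sub>R a) q = tscale r (E a q)"
    if "q \<in> W" for a b r q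
    using tadd_vec_of[OF c dom[OF that]] tscale_vec_of[OF c dom[OF that]] by (simp_all add: E_def)
  have 1: "B (a + b) d = B a d + B b d" for a b d
    using cong[of "\<lambda>q. tadd (E a q) (E b q)" "a + b" "E d" d] add
      lin[THEN conjunct1, rule_format, OF conjI[OF E conjI[OF E E]] p, of a b d]
    by (simp add: B_def tadd_def)
  have 2: "B (r *\<^sub>R a) d = r *\<^sub>R B a d" for r a d
    using cong[of "\<lambda>q. tscale r (E a q)" "r *\<^sub>R a" "E d" d] scale
      lin[THEN conjunct2, THEN conjunct2, THEN conjunct1, rule_format,
        OF conjI[OF smooth_fun_const[OF W(1)] conjI[OF E E]] p, of r a d]
    by (simp add: B_def tscale_def)
  have 3: "B d (a + b) = B d a + B d b" for a b d
    using cong[of "E d" d "\<lambda>q. tadd (E a q) (E b q)" "a + b"] add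
      lin[THEN conjunct2, THEN conjunct1, rule_format, OF conjI[OF E conjI[OF E E]] p, of d a b]
    by (simp add: B_def tadd_def)
  have 4: "B d (r *\<^sub>R a) = r *\<^sub>R B d a" for r a d
    using cong[of "E d" d "\<lambda>q. tscale r (E a q)" "r *\<^sub>R a"] scale
      lin[THEN conjunct2, THEN conjunct2, THEN conjunct2, rule_format,
        OF conjI[OF smooth_fun_const[OF W(1)] conjI[OF E E]] p, of d r a]
    by (simp add: B_def tscale_def tadd_def differential_const)
  \<comment> \<open>The first slot is expanded in axis vectors, then the second one inside each
    summand.\<close>
  have "B y y = (\<Sum>i\<in>UNIV. y $ i *\<^sub>R (\<Sum>j\<in>UNIV. y $ j *\<^sub>R B (axis i 1) (axis j 1)))"
    by (subst linear_axis_expansion[of "\<lambda>a. B a y"], force intro: linearI 1 2,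
        subst linear_axis_expansion[of "B _"], force intro: linearI 3 4, rule refl)
  moreover have "B (axis i 1) (axis j 1) $ k = christoffel A N c k i j (E y p)" for i j k
    by (simp add: B_def christoffel_def coord_field_def[abs_def] E_def)
  ultimately have "B y y = (\<chi> k. \<Sum>i\<in>UNIV. \<Sum>j\<in>UNIV. christoffel A N c k i j (E y p) * y $ i * y $ j)"
    by (simp add: vec_eq_iff sum_distrib_left mult_ac)
  then show ?thesis
    by (simp add: B_def E_def)
qed

text \<open>All fields in the metric compatibility are the constant-component field \<open>V\<close>
  through the given vector, so both sides become derivatives of the coordinate metric. The chart is
  \<open>chart_at A p\<close> because that is the one in which \<open>differential\<close> is
  computed.\<close>

lemma spray_identity:
  assumes p: "p \<in> topspace M" and c_def: "c = chart_at A p" and y: "vec_of A c p y \<in> U"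
  shows "coord_deriv c p y (y, 0) = coord_deriv c p y
    (0, \<chi> k. \<Sum>i\<in>UNIV. \<Sum>j\<in>UNIV. christoffel A N c k i j (vec_of A c p y) * y $ i * y $ j)"
proof -
  have c: "c \<in> A" "p \<in> chart_dom c"
    using chart_at_props[OF p] by (simp_all add: c_def)
  define V where "V q = vec_of A c q y" for q
  \<comment> \<open>The points at which the fixed components \<open>y\<close> still give an
    admissible vector: an open set on which \<open>V\<close> may serve as reference field.\<close>
  define W where "W = {q \<in> chart_dom c. chart_map c q \<in> (\<lambda>x. (x, y)) -` coord_domain c}"
  have W: "openin M W" "W \<subseteq> chart_dom c"
    unfolding W_def
    by (intro openin_chart_preimage c open_vimage open_coord_domain continuous_intros) blast
  have VU: "V q \<in> U" if "q \<in> W" for q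
    using that coord_domain_iff[OF c(1)] by (auto simp: W_def V_def)
  then have VU': "V ` W \<subseteq> U"
    by blast
  have pW: "p \<in> W"
    using c y coord_domain_iff[OF c] by (simp add: W_def)
  have V: "vector_field A W V"
    unfolding V_def[abs_def] using c(1) W by (rule vector_field_vec_of)
  define \<Gamma> where "\<Gamma> = comp_in c (N (V p) V V)"
  have \<Gamma>: "N (V p) V V = vec_of A c p \<Gamma>"
    unfolding \<Gamma>_def by (rule tangent_vector_eq[OF c N_tangent[OF W(1) V VU' pW V V]])
  \<comment> \<open>The two terms with the connection contribute one half each by Euler's relation
    in either slot, and the Cartan term vanishes.\<close>
  have "differential A (\<lambda>q. fund_tensor L (V q) (V q) (V q)) (V p) = coord_deriv c p y (0, \<Gamma>)"
    using metric_compatible[unfolded metric_compatible_def, rule_format,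
        OF conjI[OF W(1) conjI[OF V conjI[OF VU' conjI[OF V conjI[OF V V]]]]] pW] y
    by (simp add: \<Gamma>[unfolded V_def[of p]] V_def[of p] fund_tensor_self[OF c] cartan_tensor_self[OF c])
  \<comment> \<open>The differentiated function is \<open>L (V q)\<close>, that is, the coordinate
    metric with its second argument frozen at \<open>y\<close>; its derivative is taken in the
    direction \<open>y\<close>.\<close>
  moreover have "differential A (\<lambda>q. fund_tensor L (V q) (V q) (V q)) (V p) = coord_deriv c p y (y, 0)"
  proof -
    let ?f = "(\<lambda>q. fund_tensor L (V q) (V q) (V q)) \<circ> chart_inv c"
    have Pair: "((\<lambda>x. (x, y)) has_derivative (\<lambda>a. (a, 0))) (at (chart_map c p))"
      by (intro has_derivative_Pair has_derivative_const has_derivative_ident)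
    have "((\<lambda>x. coord_metric c (x, y)) has_derivative (\<lambda>a. coord_deriv c p y (a, 0))) (at (chart_map c p))"
      by (rule has_derivative_compose[where f = "\<lambda>x. (x, y)", OF Pair coord_metric_has_derivative[OF c y]])
    moreover have "open (chart_map c ` (W \<inter> chart_dom c))"
      by (rule open_chart_image[OF c(1) W(1)])
    moreover have "chart_map c p \<in> chart_map c ` (W \<inter> chart_dom c)"
      using pW c by blast
    moreover have "coord_metric c (x, y) = ?f x" if x: "x \<in> chart_map c ` (W \<inter> chart_dom c)" for x
    proof -
      obtain q where q: "q \<in> W \<inter> chart_dom c" "x = chart_map c q"
        using x by (rule imageE)
      then show ?thesis
        using fund_tensor_self_self[of c q y] VU[of q] c(1)
        by (simp add: chart_inv_chart_map coord_metric_eq V_def)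
    qed
    ultimately have "(?f has_derivative (\<lambda>a. coord_deriv c p y (a, 0))) (at (chart_map c p))"
      by (rule has_derivative_transform_within_open)
    from frechet_derivative_at[OF this] show ?thesis
      using comp_vec_of[OF c, of y] unfolding differential_def Let_def V_def[of p] base_vec_of c_def[symmetric]
      by metis
  qed
  moreover have "\<Gamma> = (\<chi> k. \<Sum>i\<in>UNIV. \<Sum>j\<in>UNIV. christoffel A N c k i j (vec_of A c p y) * y $ i * y $ j)"
    using N_components[OF c(1) W _ pW, of y] VU' unfolding \<Gamma>_def V_def[abs_def] by blast
  ultimately show ?thesis
    by simp
qed

end


section \<open>Energy along a motion\<close>

text \<open>Extracts the first two orders of smoothness at possibly one-sided points. The assumption
  on \<open>at s within J\<close> makes the vector derivative unique, so it equals the Frechet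
  derivative applied to 1.\<close>

lemma smooth_on_vector_derivative:
  fixes x :: "real \<Rightarrow> 'b::euclidean_space"
  assumes smooth: "smooth_on J x" and J: "\<And>s. s \<in> J \<Longrightarrow> at s within J \<noteq> bot" and t: "t \<in> J"
  shows "(x has_vector_derivative vector_derivative x (at t within J)) (at t within J)"
    and "(\<lambda>s. vector_derivative x (at s within J)) differentiable (at t within J)"
proof -
  have C2: "Ck_on (Suc (Suc 0)) J x"
    using smooth by (simp only: smooth_on_def)
  have diff: "x differentiable (at s within J)" if "s \<in> J" for s
    using C2 that by simp
  show "(x has_vector_derivative vector_derivative x (at t within J)) (at t within J)"
    using diff[OF t] vector_derivative_works by blast
  have eq: "vector_derivative x (at s within J) = frechet_derivative x (at s within J) 1" if "s \<in> J" for s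
  proof -
    let ?F = "frechet_derivative x (at s within J)"
    have F: "(x has_derivative ?F) (at s within J)"
      using diff[OF that] frechet_derivative_works by blast
    have "?F h = h *\<^sub>R ?F 1" for h
      using linear_cmul[OF has_derivative_linear[OF F], of h 1] unfolding real_scaleR_def mult_1_right .
    then have "?F = (\<lambda>h. h *\<^sub>R ?F 1)"
      by (rule ext)
    with F have "(x has_vector_derivative ?F 1) (at s within J)"
      unfolding has_vector_derivative_def by (rule has_derivative_eq_rhs)
    then show ?thesis
      by (rule vector_derivative_within[OF J[OF that]])
  qed
  have "(\<lambda>s. frechet_derivative x (at s within J) 1) differentiable (at t within J)"
    using C2 t by simp
  then obtain D where "((\<lambda>s. frechet_derivative x (at s within J) 1) has_derivative D) (at t within J)"
    unfolding differentiable_def by blast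
  then have "((\<lambda>s. vector_derivative x (at s within J)) has_derivative D) (at t within J)"
    by (rule has_derivative_transform[OF t, rotated]) (rule eq)
  then show "(\<lambda>s. vector_derivative x (at s within J)) differentiable (at t within J)"
    by (rule differentiableI)
qed

text \<open>The calculation takes place in the chart chosen at the position
  \<open>\<gamma> t\<close>. Derivatives are relative to \<open>I\<close>, so end points are
  covered; the limit point assumption makes them unique.\<close>

lemma (in chern) energy_has_derivative_zero:
  assumes \<phi>: "smooth_fun A (topspace M) \<phi>"
    and motion: "is_motion M A U N (\<lambda>v. tscale (- 1) (anisotropic_gradient A L \<phi> v)) I \<gamma>"
    and I: "\<And>t. t \<in> I \<Longrightarrow> t islimpt I" and t: "t \<in> I"
  shows "((\<lambda>s. mechanical_energy (\<lambda>v. 1/2 * L v) \<phi> (velocity A I \<gamma> s)) has_derivative (\<lambda>h. 0)) (at t within I)"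
proof -
  have curve: "continuous_map (top_of_set I) M \<gamma>"
    and smooth: "\<And>c. c \<in> A \<Longrightarrow> smooth_on {s \<in> I. \<gamma> s \<in> chart_dom c} (chart_map c \<circ> \<gamma>)"
    and in_U: "\<And>s. s \<in> I \<Longrightarrow> velocity A I \<gamma> s \<in> U"
    and newton: "cov_deriv A N I \<gamma> (velocity A I \<gamma>) t =
      tscale (- 1) (anisotropic_gradient A L \<phi> (velocity A I \<gamma> t))"
    using motion t unfolding is_motion_def smooth_curve_def by blast+
  define p where "p = \<gamma> t"
  define c where "c = chart_at A p"
  define J where "J = {s \<in> I. \<gamma> s \<in> chart_dom c}"
  define x where "x = chart_map c \<circ> \<gamma>"
  define y where "y s = comp_in c (velocity A I \<gamma> s)" for s
  have p: "p \<in> topspace M"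
    using continuous_map_image_subset_topspace[OF curve] t by (auto simp: p_def)
  have c: "c \<in> A" "p \<in> chart_dom c"
    using chart_at_props[OF p] by (simp_all add: c_def)
  have tJ: "t \<in> J"
    using t c by (simp add: J_def p_def)
  have "openin (top_of_set I) J"
    using openin_continuous_map_preimage[OF curve openin_dom[OF c(1)]] by (simp add: J_def)
  then obtain T where T: "open T" "J = I \<inter> T"
    unfolding openin_open by blast
  \<comment> \<open>\<open>J\<close> is relatively open in \<open>I\<close>, so the part of the
    curve inside the chart has the same derivatives as the whole curve.\<close>
  have at_J: "at s within J = at s within I" if "s \<in> J" for s
    by (rule at_within_nhd[where S = T]) (use that T in auto)
  have nontrivial: "at s within J \<noteq> bot" if "s \<in> J" for s
    using I[of s] that T(2) unfolding at_J[OF that] by (simp add: trivial_limit_within)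
  have velocity: "velocity A I \<gamma> s = vec_of A c (\<gamma> s) (y s)" if "s \<in> J" for s
  proof -
    have "base_pt (velocity A I \<gamma> s) = \<gamma> s"
      by (simp add: velocity_def)
    then have "velocity A I \<gamma> s \<in> tangent_space A (\<gamma> s)"
      using in_U_tangent[OF in_U, of s] that by (simp add: J_def)
    then show ?thesis
      unfolding y_def using that c(1) by (intro tangent_vector_eq) (simp_all add: J_def)
  qed
  have y_eq: "y s = vector_derivative x (at s within J)" if "s \<in> J" for s
    unfolding at_J[OF that] using that c(1) by (simp add: y_def velocity_def J_def x_def)
  note dx = smooth_on_vector_derivative[OF smooth[OF c(1), folded J_def x_def] nontrivial tJ]
  have x': "(x has_vector_derivative y t) (at t within J)"
    using dx(1) y_eq[OF tJ] by simp
  obtain D where "((\<lambda>s. vector_derivative x (at s within J)) has_derivative D) (at t within J)"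
    using dx(2) unfolding differentiable_def by blast
  then have "(y has_derivative D) (at t within J)"
    by (rule has_derivative_transform[OF tJ, rotated]) (rule y_eq)
  then obtain y' where y': "(y has_vector_derivative y') (at t within J)"
    using differentiableI vector_derivative_works by blast
  have y'_nth: "vector_derivative (\<lambda>s. y s $ k) (at t within I) = y' $ k" for k
    using vector_derivative_within[OF nontrivial[OF tJ]
        bounded_linear.has_vector_derivative[OF bounded_linear_vec_nth y']]
    unfolding at_J[OF tJ] .
  define G where "G = coord_deriv c p (y t)"
  define l where "l = frechet_derivative (\<phi> \<circ> chart_inv c) (at (chart_map c p))"
  define \<Gamma> where "\<Gamma> = (\<chi> k. \<Sum>i\<in>UNIV. \<Sum>j\<in>UNIV. christoffel A N c k i j (vec_of A c p (y t)) * y t $ i * y t $ j)"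
  have v: "velocity A I \<gamma> t = vec_of A c p (y t)"
    using velocity[OF tJ] by (simp add: p_def)
  then have vU: "vec_of A c p (y t) \<in> U"
    using in_U[OF t] by simp
  have dG: "(coord_metric c has_derivative G) (at (chart_map c p, y t))"
    unfolding G_def by (rule coord_metric_has_derivative[OF c vU])
  have "smooth_on (chart_map c ` chart_dom c) (\<phi> \<circ> chart_inv c)"
    using \<phi> c(1) dom_subset[OF c(1)] unfolding smooth_fun_def by (metis inf.absorb2)
  then have d\<phi>: "((\<phi> \<circ> chart_inv c) has_derivative l) (at (chart_map c p))"
    unfolding l_def by (rule smooth_on_has_derivative[OF homeo_chart(2)[OF c(1)]]) (use c in blast)
  have df: "differential A \<phi> (vec_of A c p w) = l w" for w
    unfolding differential_def Let_def base_vec_of c_def[symmetric] l_def comp_vec_of[OF c] ..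
  obtain \<eta> where \<eta>: "anisotropic_gradient A L \<phi> (vec_of A c p (y t)) = vec_of A c p \<eta>"
      "1/2 * G (0, \<eta>) = l (y t)"
    using gradient_represents[OF c vU has_derivative_linear[OF d\<phi>] df] unfolding G_def by blast
  \<comment> \<open>The equation of motion read off in the chart \<open>c\<close>.\<close>
  have "y' + \<Gamma> = - \<eta>"
  proof -
    have "comp_in c (cov_deriv A N I \<gamma> (velocity A I \<gamma>) t) = y' + \<Gamma>"
      using c by (simp add: cov_deriv_def p_def[symmetric] v y_def[symmetric] y'_nth \<Gamma>_def vec_eq_iff comp_vec_of)
    then show ?thesis
      unfolding newton v \<eta>(1) by (simp add: tscale_def comp_vec_of[OF c])
  qed
  then have y'_eq: "y' = - \<Gamma> - \<eta>"
    by (simp add: algebra_simps eq_neg_iff_add_eq_0)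
  have spray: "G (y t, 0) = G (0, \<Gamma>)"
    unfolding G_def \<Gamma>_def by (rule spray_identity[OF p c_def vU])
  have lin: "linear G" "linear l"
    using dG d\<phi> by (auto intro: has_derivative_linear)
  have "G (y t, y') = G (y t, 0) + G (0, - \<Gamma> - \<eta>)"
    using linear_add[OF lin(1), of "(y t, 0)" "(0, - \<Gamma> - \<eta>)"] by (simp add: y'_eq)
  also have "G (0, - \<Gamma> - \<eta>) = - G (0, \<Gamma>) - G (0, \<eta>)"
    using linear_diff[OF lin(1), of "(0, - \<Gamma>)" "(0, \<eta>)"] linear_neg[OF lin(1), of "(0, \<Gamma>)"] by simp
  \<comment> \<open>The spray identity cancels the two kinetic terms, and the gradient term cancels
    the change of the potential.\<close>
  finally have zero: "1/2 * G (y t, y') + l (y t) = 0"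
    using spray \<eta>(2) by simp
  have xt: "x t = chart_map c p"
    by (simp add: x_def p_def)
  have "((\<lambda>s. (x s, y s)) has_derivative (\<lambda>h. (h *\<^sub>R y t, h *\<^sub>R y'))) (at t within J)"
    using x' y' unfolding has_vector_derivative_def by (rule has_derivative_Pair)
  then have "((\<lambda>s. coord_metric c (x s, y s)) has_derivative (\<lambda>h. G (h *\<^sub>R y t, h *\<^sub>R y'))) (at t within J)"
    by (rule has_derivative_compose[where f = "\<lambda>s. (x s, y s)"]) (simp add: xt dG)
  moreover have "((\<lambda>s. (\<phi> \<circ> chart_inv c) (x s)) has_derivative (\<lambda>h. l (h *\<^sub>R y t))) (at t within J)"
    using x' unfolding has_vector_derivative_def
    by (rule has_derivative_compose[where f = x]) (simp only: xt d\<phi>)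
  ultimately have "((\<lambda>s. 1/2 * coord_metric c (x s, y s) + (\<phi> \<circ> chart_inv c) (x s)) has_derivative
      (\<lambda>h. 1/2 * G (h *\<^sub>R y t, h *\<^sub>R y') + l (h *\<^sub>R y t))) (at t within J)"
    by (intro has_derivative_add has_derivative_mult_right)
  moreover have "1/2 * G (h *\<^sub>R y t, h *\<^sub>R y') + l (h *\<^sub>R y t) = 0" for h
    using linear_cmul[OF lin(1), of h "(y t, y')"] linear_cmul[OF lin(2), of h "y t"]
      arg_cong[OF zero, of "\<lambda>z. h * z"] by (simp add: algebra_simps)
  ultimately have "((\<lambda>s. 1/2 * coord_metric c (x s, y s) + (\<phi> \<circ> chart_inv c) (x s)) has_derivative (\<lambda>h. 0)) (at t within J)"
    by (simp only:)
  then have "((\<lambda>s. mechanical_energy (\<lambda>v. 1/2 * L v) \<phi> (velocity A I \<gamma> s)) has_derivative (\<lambda>h. 0)) (at t within J)"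
  proof (rule has_derivative_transform[OF tJ, rotated])
    show "mechanical_energy (\<lambda>v. 1/2 * L v) \<phi> (velocity A I \<gamma> s) =
        1/2 * coord_metric c (x s, y s) + (\<phi> \<circ> chart_inv c) (x s)" if "s \<in> J" for s
      unfolding velocity[OF that] mechanical_energy_def base_vec_of x_def o_def
      using that c(1) by (simp add: J_def coord_metric_eq chart_inv_chart_map)
  qed
  then show ?thesis
    unfolding at_J[OF tJ] .
qed

theorem theorem4p3:
  fixes M :: "'a topology" and A :: "('a, 'n::finite) chart set"
    and U :: "('a, 'n) tvec set" and L :: "('a, 'n) tvec \<Rightarrow> real"
    and N :: "('a, 'n) tvec \<Rightarrow> ('a \<Rightarrow> ('a, 'n) tvec) \<Rightarrow> ('a \<Rightarrow> ('a, 'n) tvec) \<Rightarrow> ('a, 'n) tvec"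
    and \<phi> :: "'a \<Rightarrow> real" and I :: "real set" and \<gamma> :: "real \<Rightarrow> 'a"
  assumes "smooth_manifold M A"
    and "conic_pseudo_finsler M A U L"
    and "chern_connection M A U L N"
    and "smooth_fun A (topspace M) \<phi>"
    and "is_interval I"
    and "is_motion M A U N (\<lambda>v. tscale (- 1) (anisotropic_gradient A L \<phi> v)) I \<gamma>"
  shows "(\<lambda>t. mechanical_energy (\<lambda>v. 1/2 * L v) \<phi> (velocity A I \<gamma> t)) constant_on I"
proof (cases "\<exists>a. I = {a}")
  \<comment> \<open>On a one-point interval the derivative within \<open>I\<close> is not unique,
    but a function there is trivially constant.\<close>
  case True
  then show ?thesis
    by (auto simp: constant_on_def)
next
  case False
  interpret chern M A U L N
    using assms(1-3) by unfold_locales (auto simp: smooth_manifold_def)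
  \<comment> \<open>A connected set other than a singleton has no isolated points; for empty
    \<open>I\<close> this is vacuous.\<close>
  have "t islimpt I" if "t \<in> I" for t
    using connected_imp_perfect[of I t] is_interval_connected[OF assms(5)] False that by blast
  then show ?thesis
    using has_derivative_zero_constant[OF is_interval_convex[OF assms(5)]
        energy_has_derivative_zero[OF assms(4,6)]]
    unfolding constant_on_def by blast
qed

end
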